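(* Let $G$ be a uniquely 3-colorable plane graph. Then $G$ has adjacent $(3,k)$-faces for some $k\leq 5$; that is, there exist a face $f_1$ with $d(f_1)=3$ and a face $f_2$ with $d(f_2)=k\le 5$ such that $f_1$ and $f_2$ have a common edge. Moreover, the bound $5$ is best possible: there exists a uniquely 3-colorable plane graph having no adjacent $(3,k)$-faces for any $k\leq 4$ (in particular, neither adjacent $(3,3)$-faces nor adjacent $(3,4)$-faces).
   Context: A graph $G$ is uniquely $k$-colorable if its chromatic number is $k$ and $G$ has only one proper $k$-coloring up to permutation of the colors (equivalently, all proper $k$-colorings induce the same partition of $V(G)$ into $k$ independent sets). For a plane graph $G$, the degree $d(f)$ of a face $f$ is the number of edges in its boundary, cut edges being counted twice. Two faces $f_1,f_2$ of $G$ are adjacent $(i,j)$-faces if $d(f_1)=i$, $d(f_2)=j$, and $f_1$ and $f_2$ have at least one common edge. *)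

theory Defs
  imports "HOL-Analysis.Analysis"
begin

text \<open>
  Finite simple graphs are given by a vertex set \<open>V\<close> and a set \<open>A\<close> of two-element
  subsets of \<open>V\<close>.
\<close>

definition proper_coloring :: "'a set \<Rightarrow> 'a set set \<Rightarrow> nat \<Rightarrow> ('a \<Rightarrow> nat) \<Rightarrow> bool" where
  "proper_coloring V A k c \<longleftrightarrow>
     (\<forall>v\<in>V. c v < k) \<and> (\<forall>u v. {u, v} \<in> A \<longrightarrow> c u \<noteq> c v)"

definition chromatic_number :: "'a set \<Rightarrow> 'a set set \<Rightarrow> nat" where
  "chromatic_number V A = (LEAST k. \<exists>c. proper_coloring V A k c)"

definition uniquely_colorable :: "nat \<Rightarrow> 'a set \<Rightarrow> 'a set set \<Rightarrow> bool" where
  "uniquely_colorable k V A \<longleftrightarrow>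
     chromatic_number V A = k \<and>
     (\<forall>c c'. proper_coloring V A k c \<and> proper_coloring V A k c' \<longrightarrow>
        (\<exists>\<pi>. \<pi> permutes {..<k} \<and> (\<forall>v\<in>V. c' v = \<pi> (c v))))"

definition graph_components :: "'a set \<Rightarrow> 'a set set \<Rightarrow> 'a set set" where
  "graph_components V A = (\<lambda>v. {w \<in> V. (v, w) \<in> {(x, y). {x, y} \<in> A}\<^sup>*}) ` V"

definition cut_edge :: "'a set \<Rightarrow> 'a set set \<Rightarrow> 'a set \<Rightarrow> bool" where
  "cut_edge V A a \<longleftrightarrow>
     a \<in> A \<and> card (graph_components V A) < card (graph_components V (A - {a}))"

text \<open>
  A plane graph consists of a finite set \<open>V\<close> of points of the plane and a finite set
  \<open>E\<close> of arcs, each arc being given by its set of points. Every arc joins two (distinct)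
  vertices and contains no vertex other than its two ends, so that \<open>e \<inter> V\<close> is the set
  of ends of the edge \<open>e\<close>; two different edges meet at most in common ends, and they have
  different sets of ends (no parallel edges).
\<close>

definition plane_graph :: "complex set \<Rightarrow> complex set set \<Rightarrow> bool" where
  "plane_graph V E \<longleftrightarrow>
     finite V \<and> finite E \<and>
     (\<forall>e\<in>E. \<exists>g. arc g \<and> path_image g = e \<and> e \<inter> V = {pathstart g, pathfinish g}) \<and>
     (\<forall>e\<in>E. \<forall>e'\<in>E. e \<noteq> e' \<longrightarrow> e \<inter> e' \<subseteq> V) \<and>
     inj_on (\<lambda>e. e \<inter> V) E"

definition end_pairs :: "complex set \<Rightarrow> complex set set \<Rightarrow> complex set set" where
  "end_pairs V E = (\<lambda>e. e \<inter> V) ` E"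

definition faces :: "complex set \<Rightarrow> complex set set \<Rightarrow> complex set set" where
  "faces V E = components (- (V \<union> \<Union>E))"

definition boundary_edges :: "complex set set \<Rightarrow> complex set \<Rightarrow> complex set set" where
  "boundary_edges E f = {e \<in> E. e \<subseteq> frontier f}"

definition face_degree :: "complex set \<Rightarrow> complex set set \<Rightarrow> complex set \<Rightarrow> nat" where
  "face_degree V E f =
     (\<Sum>e\<in>boundary_edges E f. if cut_edge V (end_pairs V E) (e \<inter> V) then 2 else 1)"

text \<open>
  Adjacent faces are two different faces: otherwise every face of degree 3 would be adjacent to itself.
\<close>

definition has_adjacent_faces :: "complex set \<Rightarrow> complex set set \<Rightarrow> nat \<Rightarrow> nat \<Rightarrow> bool" where
  "has_adjacent_faces V E i j \<longleftrightarrow>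
     (\<exists>f\<^sub>1\<in>faces V E. \<exists>f\<^sub>2\<in>faces V E. f\<^sub>1 \<noteq> f\<^sub>2 \<and>
        face_degree V E f\<^sub>1 = i \<and> face_degree V E f\<^sub>2 = j \<and>
        boundary_edges E f\<^sub>1 \<inter> boundary_edges E f\<^sub>2 \<noteq> {})"

end

theory Submission
  imports Defs
begin

text \<open>
  In a uniquely 3-colourable graph any two colour classes induce a connected subgraph, so that a graph with \<open>n\<close>
  vertices has at least \<open>2 n - 3\<close> edges. With Euler's formula, the charges \<open>d(f) - 4\<close> of the faces of a plane
  such graph sum up to a negative number. If all neighbours of triangular faces had degree at least 6, these neighbours
  could pay \<open>1/3\<close> to each adjacent triangle, which would make all charges nonnegative.

  Euler's formula and the double counting of face degrees rest on the effect of adding one edge to a plane graph: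
  by Janiszewski's theorem a bridge does not split the face containing it, while an edge closing a cycle splits this
  face into exactly two faces, both of which have the whole edge on their frontiers.

  For sharpness it suffices to draw a uniquely 3-colourable graph in which every edge lies on a face with at least five
  boundary edges: only two faces meet at an edge, so that two faces of degree at most 4 are never adjacent.
\<close>

section \<open>Arcs and components in the plane\<close>

text \<open>With V vertices, E edges, F faces and c components, the charges sum to 2E - 4F, which is
  4V - 2E - 4c - 4 by Euler's formula. From 2V \<le> E + 3 this is at most 2 - 4c, hence at most -2;
  only c \<ge> 1 enters, so connectedness is never proved. The 5 of the statement arises because 6
  is the least degree d with d - 4 \<ge> d / 3.

  The obstacle lies in the degrees. \<open>face_degree\<close> counts arcs contained in a frontier,
  and no boundary walk is at hand, so even "every face has degree at least 3" and "a face of degree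
  3 has three boundary edges, none of them a bridge" need an argument. It runs through the subgraph
  formed by the boundary edges of a face: the face is still a face of this subgraph, which contains
  a cycle as soon as the whole graph does. And the whole graph does, because 2V - 3 edges are too
  many for a forest on at least three vertices.\<close>

text \<open>The inverse of the arc would map a disc continuously and injectively into the reals. A
  disc stays connected when a point is removed, while a set of reals does not survive the loss of a
  value between two others.\<close>

lemma arc_interior_empty:
  fixes g :: "real \<Rightarrow> complex"
  assumes "arc g"
  shows "interior (path_image g) = {}"
proof (rule ccontr)
  assume "interior (path_image g) \<noteq> {}"
  then obtain x r where r: "r > 0" and b: "ball x r \<subseteq> path_image g"
    by (metis equals0I mem_interior)
  obtain h where h: "homeomorphism {0..1} (path_image g) g h"
    using assms homeomorphism_arc by blast
  have conth: "continuous_on (path_image g) h" and gh: "\<And>y. y \<in> path_image g \<Longrightarrow> g (h y) = y"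
    using h by (auto simp: homeomorphism_def)
  have inj: "inj_on h (ball x r)"
    using gh b by (metis inj_on_def subsetD)
  have "infinite (h ` ball x r)"
  proof -
    have "uncountable (ball x r)" using r by (rule uncountable_ball)
    then show ?thesis using inj countable_finite finite_image_iff by blast
  qed
  then obtain S where S: "S \<subseteq> h ` ball x r" "finite S" "card S = 3"
    using infinite_arbitrarily_large by blast
  then obtain s t u where "s \<in> S" "t \<in> S" "u \<in> S" "s < t" "t < u"
  proof -
    define l where "l = sorted_list_of_set S"
    have l: "set l = S" "length l = 3" "sorted_wrt (<) l"
      using S by (auto simp: l_def)
    then have "l ! 0 < l ! 1" "l ! 1 < l ! 2" "l ! 0 \<in> S" "l ! 1 \<in> S" "l ! 2 \<in> S"
      using sorted_wrt_nth_less[OF l(3)] by auto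
    then show ?thesis using that by blast
  qed
  then obtain y where y: "y \<in> ball x r" "h y = t" and su: "s \<in> h ` ball x r" "u \<in> h ` ball x r"
    using S(1) by blast
  have "connected (ball x r - {y})"
    by (rule connected_open_delete) auto
  then have "connected (h ` (ball x r - {y}))"
    using conth b by (meson Diff_subset connected_continuous_image continuous_on_subset subset_trans)
  moreover have "s \<in> h ` (ball x r - {y})" "u \<in> h ` (ball x r - {y})"
    using su y \<open>s < t\<close> \<open>t < u\<close> by auto
  ultimately have "t \<in> h ` (ball x r - {y})"
    using \<open>s < t\<close> \<open>t < u\<close> by (meson connected_contains_Icc atLeastAtMost_iff less_imp_le subsetD)
  then show False
    using inj y by (auto simp: inj_on_def)
qed

text \<open>The arc without its ends is the image of the open unit interval. The closure statement
  extends facts about interior points of an edge to the whole edge.\<close>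

lemma arc_interior_connected:
  fixes g :: "real \<Rightarrow> complex"
  assumes "arc g"
  shows "connected (path_image g - {pathstart g, pathfinish g})"
    and "path_image g - {pathstart g, pathfinish g} \<noteq> {}"
    and "path_image g \<subseteq> closure (path_image g - {pathstart g, pathfinish g})"
proof -
  have eq: "path_image g - {pathstart g, pathfinish g} = g ` {0<..<1}"
  proof -
    have "inj_on g {0..1}" using assms arc_def by blast
    then show ?thesis
      by (auto simp: path_image_def pathstart_def pathfinish_def inj_on_def less_le image_iff)
  qed
  have c: "continuous_on {0..1} g"
    using assms by (simp add: arc_def path_def)
  then have "continuous_on {0<..<1} g"
    by (rule continuous_on_subset) auto
  then show "connected (path_image g - {pathstart g, pathfinish g})"
    unfolding eq by (rule connected_continuous_image) auto
  show "path_image g - {pathstart g, pathfinish g} \<noteq> {}"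
    unfolding eq by auto
  have "g ` closure {0<..<1} \<subseteq> closure (g ` {0<..<1})"
    using c by (intro image_closure_subset) (auto intro: closure_subset[THEN subsetD])
  then show "path_image g \<subseteq> closure (path_image g - {pathstart g, pathfinish g})"
    unfolding eq by (simp add: path_image_def)
qed

text \<open>Since \<open>e\<close> meets no component but \<open>F\<close>, all others survive
  unchanged, and the effect of a new edge can be studied inside a single face.\<close>

lemma components_delete:
  fixes U :: "'a::topological_space set"
  assumes F: "F \<in> components U" and e: "e \<inter> U \<subseteq> F"
  shows "components (U - e) = (components U - {F}) \<union> components (F - e)"
proof -
  have cc: "connected_component_set (U - e) x =
      (if x \<in> F then connected_component_set (F - e) x else connected_component_set U x)"
    if x: "x \<in> U - e" for x
  proof (cases "x \<in> F")
    case True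
    then have "F = connected_component_set U x"
      using F by (metis components_iff connected_component_eq)
    then have "connected_component_set (U - e) x \<subseteq> F"
      by (metis Diff_subset connected_component_mono)
    then have "connected_component_set (U - e) x \<subseteq> F - e"
      using connected_component_subset[of "U - e" x] by blast
    then have "connected_component_set (F - e) x = connected_component_set (U - e) x"
      by (rule connected_component_intermediate_subset)
         (use F in_components_subset in blast)
    then show ?thesis using True by simp
  next
    case False
    have "connected_component_set U x \<inter> F = {}"
      using F False x by (metis (no_types, lifting) DiffD1 components_iff connected_component_eq
          connected_component_nonoverlap connected_component_refl mem_Collect_eq)
    then have "connected_component_set U x \<subseteq> U - e"
      using e connected_component_subset[of U x] by blast
    then have "connected_component_set (U - e) x = connected_component_set U x"
      by (rule connected_component_intermediate_subset) auto
    then show ?thesis using False by simp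
  qed
  show ?thesis
  proof (intro set_eqI iffI)
    fix C assume "C \<in> components (U - e)"
    then obtain x where x: "x \<in> U - e" and C: "C = connected_component_set (U - e) x"
      by (auto simp: components_iff)
    show "C \<in> (components U - {F}) \<union> components (F - e)"
    proof (cases "x \<in> F")
      case True
      then show ?thesis using C x cc[OF x] by (auto simp: components_iff)
    next
      case False
      then have "C = connected_component_set U x" using C cc[OF x] by simp
      then show ?thesis using False x
        by (metis DiffD1 DiffI UnCI components_iff connected_component_refl_eq mem_Collect_eq singletonD)
    qed
  next
    fix C assume "C \<in> (components U - {F}) \<union> components (F - e)"
    then show "C \<in> components (U - e)"
    proof
      assume C: "C \<in> components U - {F}"
      then obtain x where x: "x \<in> U" and Cx: "C = connected_component_set U x"
        by (auto simp: components_iff)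
      have "C \<inter> F = {}" using C F components_nonoverlap by blast
      moreover have "x \<in> C" using x Cx by simp
      ultimately have "x \<notin> F" "x \<in> U - e" using e x by blast+
      then show ?thesis using cc[of x] Cx by (auto simp: components_iff)
    next
      assume "C \<in> components (F - e)"
      then obtain x where x: "x \<in> F - e" and Cx: "C = connected_component_set (F - e) x"
        by (auto simp: components_iff)
      then have "x \<in> U - e" using F in_components_subset by blast
      then show ?thesis using cc[of x] x Cx by (auto simp: components_iff)
    qed
  qed
qed

lemma components_two:
  fixes A B :: "'a::real_normed_vector set"
  assumes "open A" "open B" "connected A" "connected B" "A \<noteq> {}" "B \<noteq> {}" "A \<inter> B = {}"
  shows "components (A \<union> B) = {A, B}"
proof -
  have "components (\<Union>{A, B}) = {A, B}"
    by (rule components_open_unique) (use assms in \<open>auto simp: pairwise_def disjnt_def\<close>)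
  then show ?thesis by simp
qed

text \<open>An arc has no interior points, so \<open>F - path_image g\<close> is dense in the open
  set \<open>F\<close>.\<close>

lemma arc_delete_frontier:
  fixes g :: "real \<Rightarrow> complex"
  assumes "arc g" "open F" "path_image g - {pathstart g, pathfinish g} \<subseteq> F"
  shows "path_image g \<subseteq> closure (F - path_image g)"
proof -
  let ?e = "path_image g"
  have "F \<subseteq> closure (F - ?e)"
  proof
    fix x assume x: "x \<in> F"
    show "x \<in> closure (F - ?e)"
    proof (rule ccontr)
      assume "x \<notin> closure (F - ?e)"
      then have "x \<in> F \<inter> - closure (F - ?e)" using x by simp
      moreover have "open (F \<inter> - closure (F - ?e))" using assms(2) by (intro open_Int open_Compl closed_closure)
      moreover have "F \<inter> - closure (F - ?e) \<subseteq> ?e" using closure_subset[of "F - ?e"] by blast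
      ultimately have "x \<in> interior ?e" by (meson interiorI)
      then show False using arc_interior_empty[OF assms(1)] by simp
    qed
  qed
  then have "closure (?e - {pathstart g, pathfinish g}) \<subseteq> closure (F - ?e)"
    using assms(3) by (meson closed_closure closure_minimal subset_trans)
  then show ?thesis using arc_interior_connected(3)[OF assms(1)] by blast
qed

lemma arc_face:
  fixes g :: "real \<Rightarrow> complex"
  assumes "arc g" "path_image g \<inter> K = {pathstart g, pathfinish g}"
  obtains F where "F \<in> components (- K)" "path_image g - {pathstart g, pathfinish g} \<subseteq> F"
proof -
  let ?I = "path_image g - {pathstart g, pathfinish g}"
  have I: "connected ?I" "?I \<noteq> {}" by (rule arc_interior_connected[OF assms(1)])+
  have "?I \<subseteq> - K" using assms(2) by blast
  with I obtain F where "F \<in> components (- K)" "?I \<subseteq> F"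
    using exists_component_superset[of ?I "- K"] by blast
  then show ?thesis using that by blast
qed

text \<open>A bridge does not split the face it runs through: Janiszewski's theorem is applied to
  \<open>K1\<close> and the arc, which meet in one point, and then to their union and \<open>K2\<close>.\<close>

lemma components_add_bridge:
  fixes g :: "real \<Rightarrow> complex"
  assumes g: "arc g" and K: "compact K1" "compact K2" "K1 \<inter> K2 = {}"
    and a: "path_image g \<inter> K1 = {pathstart g}" and b: "path_image g \<inter> K2 = {pathfinish g}"
    and F: "F \<in> components (- (K1 \<union> K2))" and gF: "path_image g - {pathstart g, pathfinish g} \<subseteq> F"
  shows "components (- (K1 \<union> K2 \<union> path_image g)) = components (- (K1 \<union> K2)) - {F} \<union> {F - path_image g}"
    and "connected (F - path_image g)" "F - path_image g \<noteq> {}"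
proof -
  let ?e = "path_image g"
  have oF: "open F" using F K by (metis closed_Un compact_imp_closed open_Compl open_components)
  have ce: "compact ?e" using g by (simp add: compact_arc_image)
  have "?e \<subseteq> closure (F - ?e)" by (rule arc_delete_frontier[OF g oF gF])
  then show ne: "F - ?e \<noteq> {}" using g arc_imp_path path_image_nonempty by fastforce
  have cF: "connected_component (- (K1 \<union> K2)) x y" if "x \<in> F" "y \<in> F" for x y
    using that F in_components_subset[OF F] in_components_connected[OF F]
    unfolding connected_component_def by blast
  have con: "connected_component (F - ?e) x y" if x: "x \<in> F - ?e" and y: "y \<in> F - ?e" for x y
  proof -
    have c12: "connected_component (- (K1 \<union> K2)) x y" using cF x y by blast
    have c1: "connected_component (- K1) x y"
      using connected_component_of_subset[OF c12] by blast
    have c2: "connected_component (- K2) x y"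
      using connected_component_of_subset[OF c12] by blast
    have "connected (- ?e)" using connected_arc_complement[OF g] by simp
    then have e: "connected_component (- ?e) x y"
      using x y by (simp add: connected_iff_connected_component)
    have 1: "connected_component (- (?e \<union> K1)) x y"
      by (rule Janiszewski) (use ce K a e c1 in \<open>auto simp: compact_imp_closed\<close>)
    have "(?e \<union> K1) \<inter> K2 = {pathfinish g}" using b K by blast
    then have "connected_component (- ((?e \<union> K1) \<union> K2)) x y"
      by (intro Janiszewski[of "?e \<union> K1"]) (use ce K 1 c2 in \<open>auto simp: compact_imp_closed compact_Un\<close>)
    then obtain S where S: "connected S" "S \<subseteq> - ((?e \<union> K1) \<union> K2)" "x \<in> S" "y \<in> S"
      by (auto simp: connected_component_def)
    then have "S \<subseteq> F"
      using F x components_maximal[of F "- (K1 \<union> K2)" S] by blast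
    then show ?thesis using S by (auto simp: connected_component_def)
  qed
  then show c: "connected (F - ?e)" by (simp add: connected_iff_connected_component)
  have "?e \<inter> - (K1 \<union> K2) \<subseteq> F" using gF a b by blast
  then have "components (- (K1 \<union> K2) - ?e) = components (- (K1 \<union> K2)) - {F} \<union> components (F - ?e)"
    by (rule components_delete[OF F])
  moreover have "components (F - ?e) = {F - ?e}"
    by (rule components_eq_sing_iff[THEN iffD2, OF conjI[OF c ne]])
  moreover have "- (K1 \<union> K2 \<union> ?e) = - (K1 \<union> K2) - ?e" by blast
  ultimately show "components (- (K1 \<union> K2 \<union> ?e)) = components (- (K1 \<union> K2)) - {F} \<union> {F - ?e}"
    by simp
qed

text \<open>An arc \<open>g\<close> closing a cycle splits the face it runs through in two: with \<open>h\<close> an arc in \<open>K\<close>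
  joining the ends of \<open>g\<close>, the Jordan curve \<open>g \<union> h\<close> meets \<open>K\<close> in the connected set \<open>h\<close>, so that
  by Janiszewski's theorem points of the face are separated by \<open>K \<union> g\<close> only if they are
  separated by this curve.\<close>

lemma components_add_chord:
  fixes g :: "real \<Rightarrow> complex"
  assumes g: "arc g" and h: "arc h" and K: "compact K" and hK: "path_image h \<subseteq> K"
    and gh: "pathstart h = pathstart g" "pathfinish h = pathfinish g"
    and gK: "path_image g \<inter> K = {pathstart g, pathfinish g}"
    and F: "F \<in> components (- K)" and gF: "path_image g - {pathstart g, pathfinish g} \<subseteq> F"
  obtains F1 F2 where "components (- (K \<union> path_image g)) = components (- K) - {F} \<union> {F1, F2}"
    "F1 \<noteq> F2" "F1 \<union> F2 = F - path_image g" "F1 \<notin> components (- K)" "F2 \<notin> components (- K)"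
    "path_image g \<subseteq> frontier F1" "path_image g \<subseteq> frontier F2"
proof -
  let ?e = "path_image g"
  define c where "c = g +++ reversepath h"
  have pr: "path_image (reversepath h) \<subseteq> K" using hK by simp
  have sc: "simple_path c" unfolding c_def
    by (rule simple_path_join_loop) (use g h gh gK hK in \<open>auto simp: arc_reversepath\<close>)
  have cl: "pathfinish c = pathstart c" by (simp add: c_def gh)
  have pc: "path_image c = ?e \<union> path_image h"
    unfolding c_def by (subst path_image_join) (auto simp: gh)
  define J where "J = path_image c"
  define A where "A = inside J"
  define B where "B = outside J"
  have JAB: "open A" "open B" "A \<inter> B = {}" "A \<union> B = - J" "frontier A = J" "frontier B = J"
    using Jordan_inside_outside[OF sc cl] by (auto simp: A_def B_def J_def)
  have cA: "connected A" "connected B"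
    using Jordan_inside_outside[OF sc cl] by (auto simp: A_def B_def J_def)
  have oF: "open F" using F K by (metis compact_imp_closed open_Compl open_components)
  have ce: "compact ?e" using g by (simp add: compact_arc_image)
  have cJ: "compact J" unfolding J_def using sc by (simp add: compact_simple_path_image)
  have FK: "F \<subseteq> - K" using F in_components_subset by blast
  have JK: "J \<inter> K = path_image h"
  proof -
    have "{pathstart g, pathfinish g} \<subseteq> path_image h"
      using gh by (metis insert_subset empty_subsetI pathstart_in_path_image pathfinish_in_path_image)
    then show ?thesis using gK hK unfolding J_def pc by blast
  qed
  have UN: "K \<union> J = K \<union> ?e" using hK by (auto simp: J_def pc)
  have split: "F - ?e = (F \<inter> A) \<union> (F \<inter> B)"
  proof -
    have "F \<inter> J = F \<inter> ?e" using FK hK by (auto simp: J_def pc)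
    then show ?thesis using JAB(4) by blast
  qed
  have con: "connected (F \<inter> D)" if D: "D = A \<or> D = B" for D
  proof -
    have "connected_component (F \<inter> D) x y" if x: "x \<in> F \<inter> D" and y: "y \<in> F \<inter> D" for x y
    proof -
      have DJ: "connected D" "D \<subseteq> - J" using D cA JAB by auto
      have 1: "connected_component (- J) x y"
        using DJ x y by (auto simp: connected_component_def)
      have 2: "connected_component (- K) x y"
        using x y F FK in_components_connected[OF F] unfolding connected_component_def by blast
      have "connected_component (- (J \<union> K)) x y"
        by (rule Janiszewski) (use cJ K 1 2 JK connected_arc_image[OF h] in \<open>auto simp: compact_imp_closed\<close>)
      then obtain S where S: "connected S" "S \<subseteq> - (J \<union> K)" "x \<in> S" "y \<in> S"
        by (auto simp: connected_component_def)
      then have SF: "S \<subseteq> F"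
        using F x components_maximal[of F "- K" S] by blast
      have "S \<subseteq> A \<union> B" using S JAB by blast
      moreover have "A \<inter> B \<inter> S = {}" using JAB by blast
      ultimately have "A \<inter> S = {} \<or> B \<inter> S = {}"
        using S(1) JAB(1,2) unfolding connected_def by blast
      then have "S \<subseteq> D" using \<open>S \<subseteq> A \<union> B\<close> D x \<open>x \<in> S\<close> by blast
      then show ?thesis using S SF by (auto simp: connected_component_def)
    qed
    then show ?thesis by (simp add: connected_iff_connected_component)
  qed
  have I: "?e - {pathstart g, pathfinish g} \<noteq> {}" by (rule arc_interior_connected(2)[OF g])
  have fr: "?e \<subseteq> frontier (F \<inter> D)" if D: "D = A \<or> D = B" for D
  proof -
    \<comment> \<open>Each side of the Jordan curve has all of \<open>J\<close> as its frontier, and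
      \<open>F\<close> is open: points of \<open>D\<close> close to an interior point of the arc lie
      in \<open>F \<inter> D\<close>.\<close>
    have "?e - {pathstart g, pathfinish g} \<subseteq> closure (F \<inter> D)"
    proof
      fix x assume x: "x \<in> ?e - {pathstart g, pathfinish g}"
      then have "x \<in> frontier D" using D JAB by (auto simp: J_def pc)
      then have "x \<in> closure D" by (simp add: frontier_def)
      then show "x \<in> closure (F \<inter> D)"
        using open_Int_closure_subset[OF oF, of D] x gF by blast
    qed
    then have "?e \<subseteq> closure (F \<inter> D)"
      using arc_interior_connected(3)[OF g] by (meson closed_closure closure_minimal subset_trans)
    moreover have "?e \<inter> (F \<inter> D) = {}" using split D by blast
    moreover have "interior (F \<inter> D) = F \<inter> D" using D oF JAB by (auto simp: interior_open)
    ultimately show ?thesis by (auto simp: frontier_def)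
  qed
  have ne: "F \<inter> D \<noteq> {}" if D: "D = A \<or> D = B" for D
    using fr[OF D] I by auto
  have "?e \<inter> - K \<subseteq> F" using gF gK by blast
  from components_delete[OF F this]
  have "components (- (K \<union> ?e)) = components (- K) - {F} \<union> components (F - ?e)"
    by (simp add: Diff_eq)
  also have "components (F - ?e) = {F \<inter> A, F \<inter> B}"
    unfolding split by (rule components_two) (use con ne oF JAB in auto)
  finally have 1: "components (- (K \<union> ?e)) = components (- K) - {F} \<union> {F \<inter> A, F \<inter> B}" .
  have 2: "F \<inter> A \<noteq> F \<inter> B" using ne[of A] ne[of B] JAB by blast
  \<comment> \<open>An old component meeting \<open>F\<close> equals \<open>F\<close>, but the arc
    runs through \<open>F\<close> and misses \<open>F \<inter> D\<close>. As both parts are new, the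
    number of faces grows by exactly one.\<close>
  have 3: "F \<inter> D \<notin> components (- K)" if D: "D = A \<or> D = B" for D
  proof
    assume "F \<inter> D \<in> components (- K)"
    then have "F \<inter> D = F" using F ne[OF D] components_nonoverlap[of "F \<inter> D" "- K" F] by blast
    then show False using I gF split D by blast
  qed
  show ?thesis using that[OF 1 2 split[symmetric]] 3 fr by blast
qed

section \<open>Bridges and cycles\<close>

abbreviation adj_rel :: "'a set set \<Rightarrow> ('a \<times> 'a) set" where
  "adj_rel A \<equiv> {(x, y). {x, y} \<in> A}"

definition simple_on :: "'a set \<Rightarrow> 'a set set \<Rightarrow> bool" where
  "simple_on V A \<longleftrightarrow> (\<forall>a\<in>A. \<exists>x\<in>V. \<exists>y\<in>V. x \<noteq> y \<and> a = {x, y})"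

lemma simple_on_subset: "simple_on V A \<Longrightarrow> B \<subseteq> A \<Longrightarrow> simple_on V B"
  by (auto simp: simple_on_def)

lemma simple_on_finite: "simple_on V A \<Longrightarrow> finite V \<Longrightarrow> finite A"
  by (rule finite_subset[of _ "Pow V"]) (auto simp: simple_on_def)

lemma conn_sym: "(x, y) \<in> (adj_rel A)\<^sup>* \<Longrightarrow> (y, x) \<in> (adj_rel A)\<^sup>*"
proof -
  have "sym (adj_rel A)" by (auto simp: sym_def insert_commute)
  then show "(x, y) \<in> (adj_rel A)\<^sup>* \<Longrightarrow> (y, x) \<in> (adj_rel A)\<^sup>*"
    by (meson sym_rtrancl symD)
qed

lemma conn_mono: "(x, y) \<in> (adj_rel B)\<^sup>* \<Longrightarrow> B \<subseteq> A \<Longrightarrow> (x, y) \<in> (adj_rel A)\<^sup>*"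
  by (erule rtrancl_mono[THEN subsetD, rotated]) auto

text \<open>A walk using the new edge repeatedly can be shortened, so one traversal in one of the
  two directions is enough.\<close>

lemma conn_insert:
  "(x, y) \<in> (adj_rel (insert {a, b} A))\<^sup>* \<longleftrightarrow>
    (x, y) \<in> (adj_rel A)\<^sup>* \<or> (x, a) \<in> (adj_rel A)\<^sup>* \<and> (b, y) \<in> (adj_rel A)\<^sup>* \<or>
    (x, b) \<in> (adj_rel A)\<^sup>* \<and> (a, y) \<in> (adj_rel A)\<^sup>*"
proof -
  have "adj_rel (insert {a, b} A) = insert (a, b) (insert (b, a) (adj_rel A))"
    by (auto simp: doubleton_eq_iff)
  then show ?thesis
    by (auto simp: rtrancl_insert intro: rtrancl_trans)
qed

lemma conn_empty: "(x, y) \<in> (adj_rel {})\<^sup>* \<longleftrightarrow> x = y"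
  by simp

text \<open>The classes of \<open>a\<close> and \<open>b\<close> merge if they differ, and all other
  classes remain. The finer graph stands alone on one side, which avoids subtraction.\<close>

lemma components_insert_edge:
  assumes "finite V" "simple_on V B" "a \<in> V" "b \<in> V"
  shows "card (graph_components V B) =
    card (graph_components V (insert {a, b} B)) + (if (a, b) \<in> (adj_rel B)\<^sup>* then 0 else 1)"
proof -
  define C where "C v = {w \<in> V. (v, w) \<in> (adj_rel B)\<^sup>*}" for v
  define D where "D v = {w \<in> V. (v, w) \<in> (adj_rel (insert {a, b} B))\<^sup>*}" for v
  have gc: "graph_components V B = C ` V" "graph_components V (insert {a, b} B) = D ` V"
    by (auto simp: graph_components_def C_def D_def)
  show ?thesis
  proof (cases "(a, b) \<in> (adj_rel B)\<^sup>*")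
    case True
    then have "(b, a) \<in> (adj_rel B)\<^sup>*" by (rule conn_sym)
    with True have "D v = C v" for v
      unfolding C_def D_def conn_insert by (auto intro: rtrancl_trans)
    then have "D = C" by blast
    then show ?thesis using True gc by simp
  next
    case False
    have self: "v \<in> C v" if "v \<in> V" for v using that by (simp add: C_def)
    have eqC: "C v = C w" if "w \<in> C v" for v w
      using that unfolding C_def by (auto intro: rtrancl_trans conn_sym)
    have D: "D v = (if v \<in> C a \<union> C b then C a \<union> C b else C v)" if "v \<in> V" for v
      using that unfolding C_def D_def conn_insert by (auto intro: rtrancl_trans conn_sym)
    have nab: "b \<notin> C a" using False by (simp add: C_def)
    have 1: "D ` V = insert (C a \<union> C b) (C ` V - {C a, C b})"
    proof (intro set_eqI iffI)
      fix X assume "X \<in> D ` V"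
      then obtain v where v: "v \<in> V" "X = D v" by blast
      show "X \<in> insert (C a \<union> C b) (C ` V - {C a, C b})"
        using v D self by (cases "v \<in> C a \<union> C b") auto
    next
      fix X assume X: "X \<in> insert (C a \<union> C b) (C ` V - {C a, C b})"
      show "X \<in> D ` V"
      proof (cases "X = C a \<union> C b")
        case True
        then have "X = D a" using D[of a] self assms by simp
        then show ?thesis using assms by blast
      next
        case False
        then obtain v where v: "v \<in> V" "X = C v" "C v \<noteq> C a" "C v \<noteq> C b" using X by blast
        then have "v \<notin> C a \<union> C b" using eqC by blast
        then have "X = D v" using D v by simp
        then show ?thesis using v by blast
      qed
    qed
    have 2: "C a \<union> C b \<notin> C ` V - {C a, C b}"
    proof
      assume "C a \<union> C b \<in> C ` V - {C a, C b}"
      then obtain v where "C v = C a \<union> C b" "C v \<noteq> C a" by blast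
      moreover have "a \<in> C v" using calculation self assms by blast
      ultimately show False using eqC by blast
    qed
    have ne: "C a \<noteq> C b" using nab self assms by blast
    have "card (D ` V) = Suc (card (C ` V - {C a, C b}))"
      using 1 2 assms by simp
    moreover have "card (C ` V - {C a, C b}) = card (C ` V) - 2"
      using ne assms by (subst card_Diff_subset) auto
    moreover have "card (C ` V) \<ge> card {C a, C b}" using assms by (intro card_mono) auto
    ultimately show ?thesis using ne False gc by simp
  qed
qed

text \<open>Replaces the comparison of component numbers by the absence of a detour around the
  edge.\<close>

lemma cut_edge_iff:
  assumes "finite V" "simple_on V A" "{a, b} \<in> A"
  shows "cut_edge V A {a, b} \<longleftrightarrow> (a, b) \<notin> (adj_rel (A - {{a, b}}))\<^sup>*"
proof -
  have "a \<in> V" "b \<in> V" using assms by (auto simp: simple_on_def doubleton_eq_iff)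
  then have "card (graph_components V (A - {{a, b}})) = card (graph_components V (insert {a, b} (A - {{a,b}})))
    + (if (a, b) \<in> (adj_rel (A - {{a, b}}))\<^sup>* then 0 else 1)"
    by (intro components_insert_edge) (use assms simple_on_subset[OF assms(2)] in \<open>auto\<close>)
  then show ?thesis using assms by (simp add: cut_edge_def insert_absorb)
qed

lemma card_components_delete:
  assumes "finite V" "simple_on V A" "e \<in> A"
  shows "card (graph_components V (A - {e})) =
    card (graph_components V A) + (if cut_edge V A e then 1 else 0)"
proof -
  obtain a b where e: "e = {a, b}" "a \<in> V" "b \<in> V" using assms by (auto simp: simple_on_def)
  have "card (graph_components V (A - {e})) = card (graph_components V (insert {a, b} (A - {e})))
    + (if (a, b) \<in> (adj_rel (A - {e}))\<^sup>* then 0 else 1)"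
    by (intro components_insert_edge) (use assms simple_on_subset[OF assms(2)] e in \<open>auto\<close>)
  then show ?thesis using assms e cut_edge_iff[OF assms(1,2), of a b] by (simp add: insert_absorb)
qed

lemma graph_components_empty: "graph_components V {} = (\<lambda>v. {v}) ` V"
  by (auto simp: graph_components_def)

text \<open>Each edge lowers the number of components by at most one, starting from
  \<open>card V\<close>. This is the source of the edge bound for pairs of colour classes.\<close>

lemma card_graph_components_ge:
  assumes "finite V" "simple_on V A"
  shows "card V \<le> card (graph_components V A) + card A"
proof -
  have "finite A" using assms simple_on_finite by blast
  then show ?thesis using assms(2)
  proof (induction A rule: finite_induct)
    case empty
    then show ?case by (simp add: graph_components_empty card_image)
  next
    case (insert e A)
    have "simple_on V A" using insert.prems simple_on_subset by blast
    moreover have "insert e A - {e} = A" using insert by simp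
    ultimately show ?case
      using insert card_components_delete[OF assms(1) insert.prems, of e] by (simp split: if_splits)
  qed
qed

text \<open>Fewer edges leave fewer detours. Read contrapositively, an edge on a cycle of a subgraph
  is no bridge of the whole graph.\<close>

lemma cut_edge_antimono:
  assumes "finite V" "simple_on V A" "B \<subseteq> A" "e \<in> B" "cut_edge V A e"
  shows "cut_edge V B e"
proof -
  obtain a b where e: "e = {a, b}" using assms(2-4) unfolding simple_on_def by blast
  have "B - {e} \<subseteq> A - {e}" using assms by blast
  moreover have "(a, b) \<notin> (adj_rel (A - {e}))\<^sup>*"
    using cut_edge_iff[OF assms(1,2), of a b] e assms(3-5) by blast
  ultimately have "(a, b) \<notin> (adj_rel (B - {e}))\<^sup>*"
    using conn_mono by metis
  then show ?thesis
    using cut_edge_iff[OF assms(1) simple_on_subset[OF assms(2,3)], of a b] e assms(4) by simp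
qed

text \<open>A minimal set of edges joining the ends of a non-bridge \<open>e\<close> is the rest of a cycle
  through \<open>e\<close>.\<close>

lemma noncut_cycle:
  assumes V: "finite V" "simple_on V A" and e: "e \<in> A" "\<not> cut_edge V A e"
  obtains S a b where "e = {a, b}" "S \<subseteq> A - {e}" "(a, b) \<in> (adj_rel S)\<^sup>*"
    "card S \<ge> 2" "\<And>s. s \<in> insert e S \<Longrightarrow> \<not> cut_edge V (insert e S) s"
proof -
  obtain a b where ab: "e = {a, b}" "a \<noteq> b" using assms by (auto simp: simple_on_def)
  define P where "P S \<longleftrightarrow> S \<subseteq> A - {e} \<and> (a, b) \<in> (adj_rel S)\<^sup>*" for S
  have fA: "finite A" using V simple_on_finite by blast
  have "P (A - {e})" using cut_edge_iff[OF V] e ab by (simp add: P_def)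
  then obtain S where S: "P S" and min: "\<And>T. P T \<Longrightarrow> card S \<le> card T"
    using ex_has_least_nat[of P _ card] by blast
  have fS: "finite S" using S fA by (auto simp: P_def intro: finite_subset)
  have minS: "(a, b) \<notin> (adj_rel T)\<^sup>*" if "T \<subset> S" for T
  proof
    assume "(a, b) \<in> (adj_rel T)\<^sup>*"
    then have "P T" using that S by (auto simp: P_def)
    then show False using min psubset_card_mono[OF fS that] by fastforce
  qed
  have sS: "simple_on V (insert e S)" using V e S by (auto simp: P_def intro: simple_on_subset)
  have eS: "e \<notin> S" using S by (auto simp: P_def)
  have nc: "\<not> cut_edge V (insert e S) s" if s: "s \<in> insert e S" for s
  proof (cases "s = e")
    case True
    then show ?thesis using S eS ab cut_edge_iff[OF V(1) sS, of a b] by (simp add: P_def)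
  next
    case False
    then have sS': "s \<in> S" using s by simp
    then obtain c d where cd: "s = {c, d}" using sS by (auto simp: simple_on_def)
    have i: "S = insert {c, d} (S - {s})" using sS' cd by blast
    have "(a, b) \<in> (adj_rel (insert {c, d} (S - {s})))\<^sup>*" using S i by (simp add: P_def)
    moreover have "(a, b) \<notin> (adj_rel (S - {s}))\<^sup>*" by (rule minS) (use sS' in blast)
    ultimately have "(a, c) \<in> (adj_rel (S - {s}))\<^sup>* \<and> (d, b) \<in> (adj_rel (S - {s}))\<^sup>* \<or>
      (a, d) \<in> (adj_rel (S - {s}))\<^sup>* \<and> (c, b) \<in> (adj_rel (S - {s}))\<^sup>*"
      unfolding conn_insert by blast
    \<comment> \<open>The other way round the cycle: from \<open>c\<close> back to \<open>a\<close>,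
      over the edge \<open>{a, b}\<close>, then from \<open>b\<close> to \<open>d\<close>, or the
      same with \<open>a\<close> and \<open>b\<close> exchanged.\<close>
    then have "(c, d) \<in> (adj_rel (insert {a, b} (S - {s})))\<^sup>*"
      unfolding conn_insert using conn_sym by metis
    moreover have "insert e S - {s} = insert {a, b} (S - {s})" using False ab by blast
    ultimately show ?thesis using cut_edge_iff[OF V(1) sS, of c d] s cd by simp
  qed
  \<comment> \<open>No loops and no parallel edges: an empty \<open>S\<close> would force
    \<open>a = b\<close>, and a single edge would be \<open>e\<close> itself.\<close>
  have "card S \<ge> 2"
  proof (rule ccontr)
    assume "\<not> card S \<ge> 2"
    then have "card S = 0 \<or> card S = 1" by linarith
    then have "S = {} \<or> (\<exists>s. S = {s})" using fS by (auto simp: card_1_singleton_iff)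
    then show False
    proof
      assume "S = {}" then show False using S ab by (simp add: P_def)
    next
      assume "\<exists>s. S = {s}"
      then obtain c d where "S = {{c, d}}" using sS unfolding simple_on_def by blast
      then have "(a, b) \<in> (adj_rel (insert {c, d} {}))\<^sup>*" using S by (simp add: P_def)
      then have "{a, b} = {c, d}" unfolding conn_insert conn_empty using ab by auto
      then show False using \<open>S = {{c, d}}\<close> eS ab by simp
    qed
  qed
  then show ?thesis using that[of a b S] ab S nc by (auto simp: P_def)
qed

section \<open>Faces of plane graphs\<close>

abbreviation skeleton :: "complex set \<Rightarrow> complex set set \<Rightarrow> complex set" where
  "skeleton V E \<equiv> V \<union> \<Union>E"

lemma plane_graphD:
  assumes "plane_graph V E"
  shows "finite V" "finite E"
    and "\<And>e. e \<in> E \<Longrightarrow> \<exists>g. arc g \<and> path_image g = e \<and> e \<inter> V = {pathstart g, pathfinish g}"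
    and "\<And>e e'. e \<in> E \<Longrightarrow> e' \<in> E \<Longrightarrow> e \<noteq> e' \<Longrightarrow> e \<inter> e' \<subseteq> V"
    and "inj_on (\<lambda>e. e \<inter> V) E"
  using assms unfolding plane_graph_def by simp_all

lemma plane_graph_arc:
  assumes "plane_graph V E" "e \<in> E"
  obtains g where "arc g" "path_image g = e" "e \<inter> V = {pathstart g, pathfinish g}"
    "pathstart g \<noteq> pathfinish g" "e - V = path_image g - {pathstart g, pathfinish g}"
proof -
  obtain g where g: "arc g" "path_image g = e" "e \<inter> V = {pathstart g, pathfinish g}"
    using plane_graphD(3)[OF assms] by blast
  show ?thesis
  proof (rule that[OF g])
    show "pathstart g \<noteq> pathfinish g" using arc_distinct_ends[OF g(1)] by metis
    have "e - V = e - e \<inter> V" by blast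
    then show "e - V = path_image g - {pathstart g, pathfinish g}" using g(2,3) by simp
  qed
qed

lemma plane_graph_simple:
  assumes "plane_graph V E" shows "simple_on V (end_pairs V E)"
  unfolding simple_on_def end_pairs_def
proof
  fix a assume "a \<in> (\<lambda>e. e \<inter> V) ` E"
  then obtain e where e: "e \<in> E" "a = e \<inter> V" by blast
  then obtain g where "e \<inter> V = {pathstart g, pathfinish g}" "pathstart g \<noteq> pathfinish g"
    using plane_graph_arc[OF assms e(1)] by metis
  then show "\<exists>x\<in>V. \<exists>y\<in>V. x \<noteq> y \<and> a = {x, y}" using e by blast
qed

lemma plane_graph_subset:
  assumes "plane_graph V E" "E' \<subseteq> E" shows "plane_graph V E'"
proof -
  note pg = plane_graphD[OF assms(1)]
  have "finite E'" using pg(2) assms(2) finite_subset by metis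
  moreover have "inj_on (\<lambda>e. e \<inter> V) E'" using pg(5) assms(2) inj_on_subset by metis
  moreover have "\<forall>e\<in>E'. \<exists>g. arc g \<and> path_image g = e \<and> e \<inter> V = {pathstart g, pathfinish g}"
    using pg(3) subsetD[OF assms(2)] by simp
  moreover have "\<forall>e\<in>E'. \<forall>e'\<in>E'. e \<noteq> e' \<longrightarrow> e \<inter> e' \<subseteq> V"
    using pg(4) subsetD[OF assms(2)] by simp
  ultimately show ?thesis unfolding plane_graph_def using pg(1) by (intro conjI)
qed

lemmas plane_graph_finite = plane_graphD(1,2)

lemmas plane_graph_disjoint = plane_graphD(4)

lemma end_pairs_delete:
  assumes "plane_graph V E" "e \<in> E"
  shows "end_pairs V (E - {e}) = end_pairs V E - {e \<inter> V}"
  using inj_on_image_set_diff[OF plane_graphD(5)[OF assms(1)], of E "{e}"] assms(2)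
  by (simp add: end_pairs_def)

lemma end_pairs_mem: "e \<in> E \<Longrightarrow> e \<inter> V \<in> end_pairs V E"
  by (auto simp: end_pairs_def)

lemma card_end_pairs: "plane_graph V E \<Longrightarrow> card (end_pairs V E) = card E"
  unfolding end_pairs_def by (rule card_image[OF plane_graphD(5)])

lemma compact_edge:
  assumes "plane_graph V E" "e \<in> E" shows "compact e"
proof -
  obtain g where "arc g" "path_image g = e" using plane_graphD(3)[OF assms] by blast
  then show ?thesis using compact_arc_image by metis
qed

lemma compact_subskeleton:
  assumes "plane_graph V E" "C \<subseteq> V" "D \<subseteq> E" shows "compact (C \<union> \<Union>D)"
proof (rule compact_Un)
  show "compact C" using assms(1,2) plane_graph_finite(1) finite_subset finite_imp_compact by metis
  show "compact (\<Union>D)"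
  proof (rule compact_Union)
    show "finite D" using assms(1,3) plane_graph_finite(2) finite_subset by metis
    show "compact e" if "e \<in> D" for e using compact_edge[OF assms(1)] assms(3) that by blast
  qed
qed

lemma compact_skeleton: "plane_graph V E \<Longrightarrow> compact (skeleton V E)"
  by (rule compact_subskeleton) auto

lemma edge_interior_disjoint:
  assumes "plane_graph V E" "e \<in> E"
  shows "e \<inter> skeleton V (E - {e}) = e \<inter> V"
proof -
  have "e \<inter> e' \<subseteq> V" if "e' \<in> E - {e}" for e'
    using plane_graph_disjoint[OF assms(1) assms(2), of e'] that by auto
  then show ?thesis by auto
qed

lemma conn_path_component:
  assumes "plane_graph V E" "(x, y) \<in> (adj_rel (end_pairs V E))\<^sup>*" "x \<in> V"
  shows "path_component (skeleton V E) x y"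
  using assms(2,3)
proof (induction rule: rtrancl_induct)
  case base
  then show ?case by (simp add: path_component_refl_eq)
next
  case (step y z)
  then have "{y, z} \<in> end_pairs V E" by simp
  then obtain e where e: "e \<in> E" "e \<inter> V = {y, z}" by (auto simp: end_pairs_def)
  obtain g where g: "arc g" "path_image g = e"
    using plane_graph_arc[OF assms(1) e(1)] by metis
  then have "path_connected e" using path_connected_path_image arc_imp_path by metis
  then have "path_component e y z" using e(2) by (auto simp: path_connected_component)
  then have "path_component (skeleton V E) y z"
    by (rule path_component_of_subset[rotated]) (use e in blast)
  then show ?case using step path_component_trans by blast
qed

text \<open>Joining edges along a walk gives a path that may revisit points. The injective one
  needed for a Jordan curve comes from the arcwise connectedness of path components.\<close>

lemma conn_arc:
  assumes "plane_graph V E" "(x, y) \<in> (adj_rel (end_pairs V E))\<^sup>*" "x \<in> V" "x \<noteq> y"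
  obtains h where "arc h" "path_image h \<subseteq> skeleton V E" "pathstart h = x" "pathfinish h = y"
proof -
  let ?S = "path_component_set (skeleton V E) x"
  have "path_component (skeleton V E) x y" using conn_path_component assms by blast
  then have "x \<in> ?S" "y \<in> ?S" using path_component_refl path_component_mem(1) by blast+
  moreover have "path_connected ?S" by (rule path_connected_path_component)
  ultimately obtain h where "arc h" "path_image h \<subseteq> ?S" "pathstart h = x" "pathfinish h = y"
    using assms(4) unfolding path_connected_arcwise by blast
  then show ?thesis using that path_component_subset by blast
qed

lemma face_props:
  assumes "plane_graph V E" "f \<in> faces V E"
  shows "open f" "connected f" "f \<noteq> {}" "f \<inter> skeleton V E = {}" "frontier f \<subseteq> skeleton V E"
proof -
  have c: "open (- skeleton V E)" using compact_skeleton[OF assms(1)] compact_imp_closed by blast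
  have f: "f \<in> components (- skeleton V E)" using assms(2) by (simp add: faces_def)
  show "open f" using c f open_components by blast
  show "connected f" "f \<noteq> {}" using f in_components_connected in_components_nonempty by blast+
  show "f \<inter> skeleton V E = {}" using in_components_subset[OF f] by blast
  show "frontier f \<subseteq> skeleton V E"
    using frontier_of_components_closed_complement[OF compact_imp_closed[OF compact_skeleton[OF assms(1)]] f] .
qed

lemma faces_disjoint: "f \<in> faces V E \<Longrightarrow> f' \<in> faces V E \<Longrightarrow> f \<noteq> f' \<Longrightarrow> f \<inter> f' = {}"
  unfolding faces_def using components_nonoverlap by blast

section \<open>Faces around a single edge\<close>

lemma cut_edge_iff_conn:
  assumes "plane_graph V E" "e \<in> E" "e \<inter> V = {a, b}"
  shows "cut_edge V (end_pairs V E) (e \<inter> V) \<longleftrightarrow> (a, b) \<notin> (adj_rel (end_pairs V (E - {e})))\<^sup>*"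
  using cut_edge_iff[OF plane_graph_finite(1)[OF assms(1)] plane_graph_simple[OF assms(1)], of a b]
    end_pairs_delete[OF assms(1,2)] end_pairs_mem[OF assms(2), of V] assms(3) by simp

text \<open>The detour around a non-bridge supplies the second arc of the Jordan curve in
  \<open>components_add_chord\<close>.\<close>

lemma faces_add_noncut:
  assumes pg: "plane_graph V E" and e: "e \<in> E" and nc: "\<not> cut_edge V (end_pairs V E) (e \<inter> V)"
  obtains F F1 F2 where "F \<in> faces V (E - {e})" "faces V E = faces V (E - {e}) - {F} \<union> {F1, F2}"
    "F1 \<noteq> F2" "F1 \<union> F2 = F - e" "F1 \<notin> faces V (E - {e})" "F2 \<notin> faces V (E - {e})"
    "e \<subseteq> frontier F1" "e \<subseteq> frontier F2" "e - V \<subseteq> F"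
proof -
  let ?K = "skeleton V (E - {e})"
  have pg': "plane_graph V (E - {e})" using plane_graph_subset[OF pg] by blast
  obtain g where g: "arc g" "path_image g = e" "e \<inter> V = {pathstart g, pathfinish g}"
    "pathstart g \<noteq> pathfinish g" "e - V = path_image g - {pathstart g, pathfinish g}"
    by (rule plane_graph_arc[OF pg e])
  have "(pathstart g, pathfinish g) \<in> (adj_rel (end_pairs V (E - {e})))\<^sup>*"
    using nc cut_edge_iff_conn[OF pg e g(3)] by blast
  then obtain h where h: "arc h" "path_image h \<subseteq> ?K" "pathstart h = pathstart g" "pathfinish h = pathfinish g"
    using conn_arc[OF pg', of "pathstart g" "pathfinish g"] g by blast
  have gK: "path_image g \<inter> ?K = {pathstart g, pathfinish g}"
    using edge_interior_disjoint[OF pg e] g by simp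
  obtain F where F: "F \<in> components (- ?K)" "path_image g - {pathstart g, pathfinish g} \<subseteq> F"
    using arc_face[OF g(1) gK] by blast
  have sk: "skeleton V E = ?K \<union> path_image g" using e g(2) by blast
  obtain F1 F2 where "components (- (?K \<union> path_image g)) = components (- ?K) - {F} \<union> {F1, F2}"
    "F1 \<noteq> F2" "F1 \<union> F2 = F - path_image g" "F1 \<notin> components (- ?K)" "F2 \<notin> components (- ?K)"
    "path_image g \<subseteq> frontier F1" "path_image g \<subseteq> frontier F2"
    using components_add_chord[OF g(1) h(1) compact_skeleton[OF pg'] h(2,3,4) gK F] by blast
  then show ?thesis using that[of F F1 F2] F g sk unfolding faces_def by metis
qed

text \<open>Without the bridge \<open>e\<close>, no edge leaves the set \<open>C\<close> of vertices
  joined to one of its ends. So the rest of the skeleton falls into two disjoint compact sets, each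
  containing one end of \<open>e\<close>, as \<open>components_add_bridge\<close> requires.\<close>

lemma faces_add_cut:
  assumes pg: "plane_graph V E" and e: "e \<in> E" and nc: "cut_edge V (end_pairs V E) (e \<inter> V)"
  obtains F where "F \<in> faces V (E - {e})" "faces V E = faces V (E - {e}) - {F} \<union> {F - e}"
    "F - e \<notin> faces V (E - {e})" "e \<subseteq> frontier (F - e)" "e - V \<subseteq> F"
proof -
  let ?K = "skeleton V (E - {e})"
  have pg': "plane_graph V (E - {e})" using plane_graph_subset[OF pg] by blast
  obtain g where g: "arc g" "path_image g = e" "e \<inter> V = {pathstart g, pathfinish g}"
    "pathstart g \<noteq> pathfinish g" "e - V = path_image g - {pathstart g, pathfinish g}"
    by (rule plane_graph_arc[OF pg e])
  define a b where "a = pathstart g" and "b = pathfinish g"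
  have ab: "e \<inter> V = {a, b}" "a \<noteq> b" using g by (auto simp: a_def b_def)
  define C where "C = {v \<in> V. (a, v) \<in> (adj_rel (end_pairs V (E - {e})))\<^sup>*}"
  have aC: "a \<in> C" and bC: "b \<notin> C"
    using nc cut_edge_iff_conn[OF pg e ab(1)] ab by (auto simp: C_def)
  have CV: "C \<subseteq> V" by (auto simp: C_def)
  have sep: "e' \<inter> V \<subseteq> C \<or> e' \<inter> V \<inter> C = {}" if e': "e' \<in> E - {e}" for e'
  proof -
    obtain x y where xy: "e' \<inter> V = {x, y}" using plane_graph_arc[OF pg', of e'] e' by metis
    then have "{x, y} \<in> end_pairs V (E - {e})" using end_pairs_mem[OF e', of V] by simp
    then have "(x, y) \<in> (adj_rel (end_pairs V (E - {e})))\<^sup>*" "(y, x) \<in> (adj_rel (end_pairs V (E - {e})))\<^sup>*"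
      by (auto simp: insert_commute)
    then have "x \<in> C \<longleftrightarrow> y \<in> C" using xy unfolding C_def by (auto intro: rtrancl_trans)
    then show ?thesis unfolding xy by blast
  qed
  define E1 where "E1 = {e' \<in> E - {e}. e' \<inter> V \<subseteq> C}"
  define E2 where "E2 = {e' \<in> E - {e}. e' \<inter> V \<inter> C = {}}"
  define K1 where "K1 = C \<union> \<Union>E1"
  define K2 where "K2 = (V - C) \<union> \<Union>E2"
  have E12: "E1 \<union> E2 = E - {e}" using sep by (auto simp: E1_def E2_def)
  have K12: "K1 \<union> K2 = ?K" using E12 CV unfolding K1_def K2_def by blast
  have "compact K1" unfolding K1_def
    by (rule compact_subskeleton[OF pg CV]) (auto simp: E1_def)
  moreover have "compact K2" unfolding K2_def
    by (rule compact_subskeleton[OF pg]) (auto simp: E2_def)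
  moreover have "K1 \<inter> K2 = {}"
  proof -
    have "e1 \<inter> e2 = {}" if "e1 \<in> E1" "e2 \<in> E2" for e1 e2
    proof -
      have V12: "e1 \<inter> V \<inter> (e2 \<inter> V) = {}" using that by (auto simp: E1_def E2_def)
      have "e1 \<inter> V \<noteq> {}"
        using plane_graph_arc[OF pg, of e1] that(1) unfolding E1_def by (metis DiffD1 insert_not_empty mem_Collect_eq)
      then have "e1 \<noteq> e2" using V12 by blast
      then have "e1 \<inter> e2 \<subseteq> V"
        using plane_graph_disjoint[OF pg', of e1 e2] that by (auto simp: E1_def E2_def)
      then show ?thesis using V12 by blast
    qed
    moreover have "(V - C) \<inter> e1 = {}" if "e1 \<in> E1" for e1 using that by (auto simp: E1_def)
    moreover have "C \<inter> e2 = {}" if "e2 \<in> E2" for e2 using that CV by (auto simp: E2_def)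
    ultimately show ?thesis unfolding K1_def K2_def by blast
  qed
  moreover have eK: "e \<inter> ?K = {a, b}"
    using edge_interior_disjoint[OF pg e] ab(1) by simp
  moreover have "path_image g \<inter> K1 = {pathstart g}"
  proof -
    have "K1 \<subseteq> ?K" unfolding K12[symmetric] by (rule Un_upper1)
    then have "path_image g \<inter> K1 \<subseteq> {a, b}"
      unfolding g(2) eK[symmetric] by (rule Int_mono[OF order_refl])
    moreover have "b \<notin> K1" using bC ab by (auto simp: K1_def E1_def)
    moreover have "a \<in> K1" using aC by (simp add: K1_def)
    moreover have "a \<in> path_image g" unfolding a_def by (rule pathstart_in_path_image)
    ultimately show ?thesis unfolding a_def[symmetric] by blast
  qed
  moreover have "path_image g \<inter> K2 = {pathfinish g}"
  proof -
    have "K2 \<subseteq> ?K" unfolding K12[symmetric] by (rule Un_upper2)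
    then have "path_image g \<inter> K2 \<subseteq> {a, b}"
      unfolding g(2) eK[symmetric] by (rule Int_mono[OF order_refl])
    moreover have "a \<notin> K2" using aC ab by (auto simp: K2_def E2_def)
    moreover have "b \<in> K2" using bC ab by (auto simp: K2_def)
    moreover have "b \<in> path_image g" unfolding b_def by (rule pathfinish_in_path_image)
    ultimately show ?thesis unfolding b_def[symmetric] by blast
  qed
  moreover have gK: "path_image g \<inter> ?K = {pathstart g, pathfinish g}"
    using edge_interior_disjoint[OF pg e] g by simp
  moreover obtain F where F: "F \<in> components (- ?K)" "path_image g - {pathstart g, pathfinish g} \<subseteq> F"
    using arc_face[OF g(1) gK] by blast
  ultimately have 1: "components (- (?K \<union> path_image g)) = components (- ?K) - {F} \<union> {F - path_image g}"
    "connected (F - path_image g)" "F - path_image g \<noteq> {}"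
    using components_add_bridge[OF g(1), of K1 K2 F] unfolding K12 by metis+
  have sk: "skeleton V E = ?K \<union> path_image g" using e g(2) by blast
  have oF: "open F" using F face_props(1)[OF pg'] by (simp add: faces_def)
  have "e \<subseteq> closure (F - e)" using arc_delete_frontier[OF g(1) oF F(2)] g(2) by simp
  moreover have "interior (F - e) = F - e"
    using oF compact_edge[OF pg e] by (simp add: interior_open compact_imp_closed open_Diff)
  ultimately have 2: "e \<subseteq> frontier (F - e)" by (auto simp: frontier_def)
  have "F - e \<notin> components (- ?K)"
  proof
    assume "F - e \<in> components (- ?K)"
    then have "F - e = F" using F(1) 1(3) g(2) components_nonoverlap[of "F - e" "- ?K" F] by blast
    then show False using F(2) arc_interior_connected(2)[OF g(1)] g(2) by blast
  qed
  then show ?thesis using that[of F] F g(2,5) sk 1 2 unfolding faces_def by simp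
qed

text \<open>Any face other than the two new ones is disjoint from the open set \<open>F\<close> that
  holds the interior of \<open>e\<close>, so its closure misses this interior. The last clause
  assumes only that \<open>closure f\<close> touches \<open>e - V\<close>, so that one point decides
  about the whole edge.\<close>

lemma faces_at_noncut:
  assumes pg: "plane_graph V E" and e: "e \<in> E" and nc: "\<not> cut_edge V (end_pairs V E) (e \<inter> V)"
  obtains F1 F2 where "F1 \<in> faces V E" "F2 \<in> faces V E" "F1 \<noteq> F2"
    "e \<subseteq> frontier F1" "e \<subseteq> frontier F2"
    "\<forall>f\<in>faces V E. closure f \<inter> (e - V) \<noteq> {} \<longrightarrow> f = F1 \<or> f = F2"
proof -
  obtain F F1 F2 where F: "F \<in> faces V (E - {e})" "faces V E = faces V (E - {e}) - {F} \<union> {F1, F2}"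
    "F1 \<noteq> F2" "F1 \<union> F2 = F - e" "F1 \<notin> faces V (E - {e})" "F2 \<notin> faces V (E - {e})"
    "e \<subseteq> frontier F1" "e \<subseteq> frontier F2" "e - V \<subseteq> F"
    by (rule faces_add_noncut[OF pg e nc])
  have oF: "open F" using face_props(1)[OF plane_graph_subset[OF pg] F(1)] by blast
  have "f = F1 \<or> f = F2" if f: "f \<in> faces V E" "closure f \<inter> (e - V) \<noteq> {}" for f
  proof (rule ccontr)
    assume "\<not> (f = F1 \<or> f = F2)"
    then have "f \<in> faces V (E - {e})" "f \<noteq> F" using f(1) F(2) by auto
    then have "f \<inter> F = {}" using faces_disjoint F(1) by metis
    then have "closure f \<inter> F = {}" using oF open_Int_closure_eq_empty by blast
    then show False using f(2) F(9) by blast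
  qed
  then show ?thesis using that[of F1 F2] F(2,3,7,8) by simp
qed

lemma faces_at_cut:
  assumes pg: "plane_graph V E" and e: "e \<in> E" and nc: "cut_edge V (end_pairs V E) (e \<inter> V)"
  obtains F1 where "F1 \<in> faces V E" "e \<subseteq> frontier F1"
    "\<forall>f\<in>faces V E. closure f \<inter> (e - V) \<noteq> {} \<longrightarrow> f = F1"
proof -
  obtain F where F: "F \<in> faces V (E - {e})" "faces V E = faces V (E - {e}) - {F} \<union> {F - e}"
    "F - e \<notin> faces V (E - {e})" "e \<subseteq> frontier (F - e)" "e - V \<subseteq> F"
    by (rule faces_add_cut[OF pg e nc])
  have oF: "open F" using face_props(1)[OF plane_graph_subset[OF pg] F(1)] by blast
  have uniq: "f = F - e" if f: "f \<in> faces V E" "closure f \<inter> (e - V) \<noteq> {}" for f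
  proof (rule ccontr)
    assume "\<not> (f = F - e)"
    then have "f \<in> faces V (E - {e})" "f \<noteq> F" using f(1) F(2) by auto
    then have "f \<inter> F = {}" using faces_disjoint F(1) by metis
    then have "closure f \<inter> F = {}" using oF open_Int_closure_eq_empty by blast
    then show False using f(2) F(5) by blast
  qed
  show ?thesis
  proof (rule that)
    show "F - e \<in> faces V E" using F(2) by simp
    show "e \<subseteq> frontier (F - e)" by (rule F(4))
    show "\<forall>f\<in>faces V E. closure f \<inter> (e - V) \<noteq> {} \<longrightarrow> f = F - e" using uniq by blast
  qed
qed

lemma edge_interior_nonempty:
  assumes "plane_graph V E" "e \<in> E" shows "e - V \<noteq> {}"
proof -
  obtain g where "arc g" "e - V = path_image g - {pathstart g, pathfinish g}"
    using plane_graph_arc[OF assms] by metis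
  then show ?thesis using arc_interior_connected(2) by metis
qed

lemma frontier_edge_closure:
  assumes "plane_graph V E" "e \<in> E" "e \<subseteq> frontier f" shows "closure f \<inter> (e - V) \<noteq> {}"
  using edge_interior_nonempty[OF assms(1,2)] assms(3) unfolding frontier_def by blast

text \<open>Turns the condition on the whole edge in \<open>boundary_edges\<close> into a test at
  one point, as needed for frontier points and for points seen from inside a face.\<close>

lemma boundary_edgeI:
  assumes pg: "plane_graph V E" and "e \<in> E" "f \<in> faces V E" "closure f \<inter> (e - V) \<noteq> {}"
  shows "e \<in> boundary_edges E f"
proof (cases "cut_edge V (end_pairs V E) (e \<inter> V)")
  case True
  show ?thesis
    by (rule faces_at_cut[OF pg assms(2) True]) (use assms in \<open>auto simp: boundary_edges_def\<close>)
next
  case False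
  show ?thesis
    by (rule faces_at_noncut[OF pg assms(2) False]) (use assms in \<open>auto simp: boundary_edges_def\<close>)
qed

section \<open>Euler's formula and the sum of the face degrees\<close>

text \<open>A bridge joins two components and keeps the number of faces; any other edge keeps the
  components and adds one face. Finiteness is carried through the same induction because the
  cardinalities are meaningful only with it.\<close>

lemma finite_faces: "plane_graph V E \<Longrightarrow> finite (faces V E)"
  and card_faces: "plane_graph V E \<Longrightarrow>
    card (faces V E) + card V = card E + card (graph_components V (end_pairs V E)) + 1"
proof -
  have "finite (faces V E) \<and> card (faces V E) + card V = card E + card (graph_components V (end_pairs V E)) + 1"
    if "plane_graph V E" for V E
    using plane_graph_finite(2)[OF that] that
  proof (induction E rule: finite_induct)
    case empty
    have fV: "finite V" using plane_graph_finite(1)[OF empty] .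
    then have "connected (- V)"
      using connected_open_delete_finite[of "UNIV::complex set" V] connected_UNIV
      by (simp add: Compl_eq_Diff_UNIV)
    moreover have "- V \<noteq> {}"
      using fV infinite_UNIV_char_0[where 'a = complex] by (metis double_complement Compl_empty_eq)
    ultimately have "faces V {} = {- V}"
      unfolding faces_def by (simp add: components_eq_sing_iff)
    moreover have "card (graph_components V {}) = card V"
      unfolding graph_components_empty by (simp add: card_image)
    ultimately show ?case by (simp add: end_pairs_def)
  next
    case (insert e E)
    have pg': "plane_graph V E" using plane_graph_subset[OF insert.prems] by blast
    note IH = insert.IH[OF pg']
    have eE: "insert e E - {e} = E" using insert.hyps by simp
    have ep: "end_pairs V E = end_pairs V (insert e E) - {e \<inter> V}"
      using end_pairs_delete[OF insert.prems, of e] eE by simp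
    have comp: "card (graph_components V (end_pairs V E)) = card (graph_components V (end_pairs V (insert e E))) +
      (if cut_edge V (end_pairs V (insert e E)) (e \<inter> V) then 1 else 0)"
      unfolding ep
      by (rule card_components_delete[OF plane_graph_finite(1)[OF pg'] plane_graph_simple[OF insert.prems]])
         (simp add: end_pairs_def)
    show ?case
    proof (cases "cut_edge V (end_pairs V (insert e E)) (e \<inter> V)")
      case True
      obtain F where F: "F \<in> faces V E" "faces V (insert e E) = faces V E - {F} \<union> {F - e}"
        "F - e \<notin> faces V E"
        by (rule faces_add_cut[OF insert.prems _ True, unfolded eE]) auto
      have "card (faces V (insert e E)) = card (faces V E)"
        using F IH card_Suc_Diff1[of "faces V E" F] by simp
      then show ?thesis using IH F comp True insert.hyps by simp
    next
      case False
      obtain F F1 F2 where F: "F \<in> faces V E" "faces V (insert e E) = faces V E - {F} \<union> {F1, F2}"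
        "F1 \<noteq> F2" "F1 \<notin> faces V E" "F2 \<notin> faces V E"
        by (rule faces_add_noncut[OF insert.prems _ False, unfolded eE]) auto
      have "card (faces V (insert e E)) = Suc (card (faces V E))"
        using F IH card_Suc_Diff1[of "faces V E" F] by simp
      then show ?thesis using IH F comp False insert.hyps by simp
    qed
  qed
  then show "plane_graph V E \<Longrightarrow> finite (faces V E)"
    "plane_graph V E \<Longrightarrow>
      card (faces V E) + card V = card E + card (graph_components V (end_pairs V E)) + 1"
    by blast+
qed

text \<open>A bridge stays a bridge in every subgraph, so deleting the edges of a forest one by one
  creates a component each time. Hence \<open>card V\<close> is the number of edges plus that of
  components, and Euler's formula leaves one face.\<close>

lemma faces_all_cut:
  assumes "plane_graph V E" "\<And>e. e \<in> E \<Longrightarrow> cut_edge V (end_pairs V E) (e \<inter> V)"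
  shows "faces V E = {- skeleton V E}"
proof -
  have "finite D \<Longrightarrow> D \<subseteq> E \<Longrightarrow> card (graph_components V (end_pairs V (E - D))) =
    card (graph_components V (end_pairs V E)) + card D" for D
  proof (induction D rule: finite_induct)
    case (insert e D)
    have pg: "plane_graph V (E - D)" using plane_graph_subset[OF assms(1)] by blast
    have e: "e \<in> E - D" "e \<in> E" using insert by auto
    have sub: "end_pairs V (E - D) \<subseteq> end_pairs V E" by (auto simp: end_pairs_def)
    have cut: "cut_edge V (end_pairs V (E - D)) (e \<inter> V)"
      by (rule cut_edge_antimono[OF plane_graph_finite(1)[OF assms(1)] plane_graph_simple[OF assms(1)] sub
            end_pairs_mem[OF e(1)] assms(2)[OF e(2)]])
    have "E - insert e D = E - D - {e}" by blast
    then have "end_pairs V (E - insert e D) = end_pairs V (E - D) - {e \<inter> V}"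
      using end_pairs_delete[OF pg e(1)] by simp
    then show ?case
      using card_components_delete[OF plane_graph_finite(1)[OF pg] plane_graph_simple[OF pg] end_pairs_mem[OF e(1)]]
        cut insert by simp
  qed simp
  from this[of E] have "card (graph_components V {}) = card (graph_components V (end_pairs V E)) + card E"
    using plane_graph_finite[OF assms(1)] by (simp add: end_pairs_def)
  moreover have "card (graph_components V {}) = card V"
    unfolding graph_components_empty by (simp add: card_image)
  ultimately have "card (faces V E) = 1" using card_faces[OF assms(1)] by linarith
  then obtain f where f: "faces V E = {f}" by (metis card_1_singletonE)
  moreover have "\<Union>(faces V E) = - skeleton V E" unfolding faces_def by (rule Union_components)
  ultimately show ?thesis by simp
qed

lemma card_faces_at:
  assumes pg: "plane_graph V E" and e: "e \<in> E"
  shows "card {f \<in> faces V E. e \<in> boundary_edges E f} =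
    (if cut_edge V (end_pairs V E) (e \<inter> V) then 1 else 2)"
proof (cases "cut_edge V (end_pairs V E) (e \<inter> V)")
  case True
  obtain F1 where F: "F1 \<in> faces V E" "e \<subseteq> frontier F1"
    "\<forall>f\<in>faces V E. closure f \<inter> (e - V) \<noteq> {} \<longrightarrow> f = F1"
    by (rule faces_at_cut[OF pg e True])
  have "{f \<in> faces V E. e \<in> boundary_edges E f} = {F1}"
    using F(1,2) F(3) frontier_edge_closure[OF pg e] e unfolding boundary_edges_def by blast
  then show ?thesis using True by simp
next
  case False
  obtain F1 F2 where F: "F1 \<in> faces V E" "F2 \<in> faces V E" "F1 \<noteq> F2"
    "e \<subseteq> frontier F1" "e \<subseteq> frontier F2"
    "\<forall>f\<in>faces V E. closure f \<inter> (e - V) \<noteq> {} \<longrightarrow> f = F1 \<or> f = F2"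
    by (rule faces_at_noncut[OF pg e False])
  have "{f \<in> faces V E. e \<in> boundary_edges E f} = {F1, F2}"
    using F(1,2,4,5) F(6) frontier_edge_closure[OF pg e] e unfolding boundary_edges_def by blast
  then show ?thesis using False F(3) by simp
qed

text \<open>Every edge counts 2 in all: a bridge on one face with weight 2, any other edge on two
  faces with weight 1.\<close>

lemma sum_face_degree:
  assumes pg: "plane_graph V E"
  shows "(\<Sum>f\<in>faces V E. face_degree V E f) = 2 * card E"
proof -
  let ?w = "\<lambda>e. if cut_edge V (end_pairs V E) (e \<inter> V) then 2 else (1::nat)"
  have "(\<Sum>f\<in>faces V E. face_degree V E f) = (\<Sum>f\<in>faces V E. \<Sum>e | e \<in> E \<and> e \<in> boundary_edges E f. ?w e)"
    unfolding face_degree_def by (intro sum.cong) (auto simp: boundary_edges_def)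
  also have "\<dots> = (\<Sum>e\<in>E. \<Sum>f | f \<in> faces V E \<and> e \<in> boundary_edges E f. ?w e)"
    by (rule sum.swap_restrict[OF finite_faces[OF pg] plane_graph_finite(2)[OF pg]])
  also have "\<dots> = (\<Sum>e\<in>E. 2)"
    by (intro sum.cong) (auto simp: card_faces_at[OF pg])
  finally show ?thesis by simp
qed

section \<open>The boundary subgraph of a face\<close>

lemma frontier_face_subset:
  assumes pg: "plane_graph V E" and f: "f \<in> faces V E"
  shows "frontier f \<subseteq> skeleton V (boundary_edges E f)"
proof
  fix x assume x: "x \<in> frontier f"
  then have "x \<in> skeleton V E" using face_props(5)[OF pg f] by blast
  then consider "x \<in> V" | e where "e \<in> E" "x \<in> e - V" by blast
  then show "x \<in> skeleton V (boundary_edges E f)"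
  proof cases
    case 2
    then have "e \<in> boundary_edges E f"
      using boundary_edgeI[OF pg _ f, of e] x by (auto simp: frontier_def)
    then show ?thesis using 2 by blast
  qed blast
qed

text \<open>A connected set growing beyond \<open>f\<close> would meet the frontier of
  \<open>f\<close>, which consists of vertices and points of boundary edges. So the boundary can be
  studied as a plane graph of its own.\<close>

lemma face_of_boundary:
  assumes pg: "plane_graph V E" and f: "f \<in> faces V E"
  shows "f \<in> faces V (boundary_edges E f)"
proof -
  let ?S = "skeleton V (boundary_edges E f)"
  have sub: "?S \<subseteq> skeleton V E" by (auto simp: boundary_edges_def)
  have fS: "f \<subseteq> - ?S" using face_props(4)[OF pg f] sub by blast
  have ne: "f \<noteq> {}" using face_props(3)[OF pg f] .
  have "C = f" if C: "f \<subseteq> C" "C \<subseteq> - ?S" "connected C" for C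
  proof (rule ccontr)
    assume "C \<noteq> f"
    then have "C - f \<noteq> {}" using C by blast
    moreover have "C \<inter> f \<noteq> {}" using C ne by blast
    ultimately have "C \<inter> frontier f \<noteq> {}" using connected_Int_frontier[OF C(3)] by blast
    then show False using frontier_face_subset[OF pg f] C by blast
  qed
  then show ?thesis unfolding faces_def in_components_maximal
    using face_props(2,3)[OF pg f] fS by blast
qed

lemma plane_graph_boundary: "plane_graph V E \<Longrightarrow> plane_graph V (boundary_edges E f)"
  by (erule plane_graph_subset) (auto simp: boundary_edges_def)

text \<open>If the boundary edges formed a forest, its complement would be its only face and hence
  equal \<open>f\<close>. This leaves no room for further edges, so the whole graph would be this
  forest and \<open>e\<close> a bridge.\<close>

lemma boundary_has_noncut:
  assumes pg: "plane_graph V E" and f: "f \<in> faces V E"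
    and e: "e \<in> E" "\<not> cut_edge V (end_pairs V E) (e \<inter> V)"
  obtains e' where "e' \<in> boundary_edges E f" "\<not> cut_edge V (end_pairs V (boundary_edges E f)) (e' \<inter> V)"
proof (rule ccontr)
  let ?B = "boundary_edges E f"
  assume neg: "\<not> thesis"
  note witness = that
  have all: "cut_edge V (end_pairs V ?B) (e' \<inter> V)" if "e' \<in> ?B" for e'
    using witness[of e'] neg that by blast
  have "faces V ?B = {- skeleton V ?B}"
    by (rule faces_all_cut[OF plane_graph_boundary[OF pg] all])
  then have fB: "f = - skeleton V ?B" using face_of_boundary[OF pg f] by simp
  have "e' \<in> ?B" if e': "e' \<in> E" for e'
  proof -
    obtain x where x: "x \<in> e' - V" using edge_interior_nonempty[OF pg e'] by blast
    then have "x \<notin> f" using face_props(4)[OF pg f] e' by blast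
    then obtain d where d: "d \<in> ?B" "x \<in> d" using fB x by blast
    then have "d \<in> E" by (simp add: boundary_edges_def)
    then have "d = e'" using plane_graph_disjoint[OF pg _ e', of d] x d by blast
    then show ?thesis using d by simp
  qed
  then have "?B = E" by (auto simp: boundary_edges_def)
  then show False using all e by metis
qed

text \<open>A cycle of the boundary subgraph has at least three edges, and none of them is a bridge
  of the larger graph. The set \<open>N\<close> itself is returned because bridges on the boundary
  are to be counted on top of it.\<close>

lemma face_degree_ge3:
  assumes pg: "plane_graph V E" and f: "f \<in> faces V E"
    and e: "e \<in> E" "\<not> cut_edge V (end_pairs V E) (e \<inter> V)"
  obtains N where "N \<subseteq> boundary_edges E f" "card N \<ge> 3"
    "\<And>e. e \<in> N \<Longrightarrow> \<not> cut_edge V (end_pairs V E) (e \<inter> V)"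
proof -
  let ?B = "boundary_edges E f"
  obtain d where d: "d \<in> ?B" "\<not> cut_edge V (end_pairs V ?B) (d \<inter> V)"
    by (rule boundary_has_noncut[OF pg f e])
  have pgB: "plane_graph V ?B" by (rule plane_graph_boundary[OF pg])
  let ?d = "d \<inter> V"
  obtain S a b where S: "?d = {a, b}" "S \<subseteq> end_pairs V ?B - {?d}" "(a, b) \<in> (adj_rel S)\<^sup>*"
    "card S \<ge> 2" "\<And>s. s \<in> insert ?d S \<Longrightarrow> \<not> cut_edge V (insert ?d S) s"
    using noncut_cycle[OF plane_graph_finite(1)[OF pgB] plane_graph_simple[OF pgB] end_pairs_mem[OF d(1)] d(2)]
    by metis
  define N where "N = {e \<in> ?B. e \<inter> V \<in> insert ?d S}"
  have sub: "insert ?d S \<subseteq> end_pairs V ?B" using S(2) end_pairs_mem[OF d(1)] by blast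
  then have "insert ?d S = (\<lambda>e. e \<inter> V) ` N" by (auto simp: N_def end_pairs_def)
  moreover have fN: "finite N"
    using plane_graph_finite(2)[OF pgB] by (simp add: N_def)
  ultimately have "card (insert ?d S) \<le> card N" using card_image_le by metis
  moreover have "card (insert ?d S) = Suc (card S)"
    using S(2,4) by (metis Diff_iff card.infinite card_insert_disjoint not_numeral_le_zero singletonI subsetD)
  ultimately have 1: "card N \<ge> 3" using S(4) by linarith
  have sub2: "insert ?d S \<subseteq> end_pairs V E" using sub by (auto simp: end_pairs_def boundary_edges_def)
  have "\<not> cut_edge V (end_pairs V E) (e \<inter> V)" if "e \<in> N" for e
  proof
    have m: "e \<inter> V \<in> insert ?d S" using that by (simp add: N_def)
    assume "cut_edge V (end_pairs V E) (e \<inter> V)"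
    then have "cut_edge V (insert ?d S) (e \<inter> V)"
      using cut_edge_antimono[OF plane_graph_finite(1)[OF pg] plane_graph_simple[OF pg] sub2 m] by blast
    then show False using S(5)[OF m] by blast
  qed
  then show ?thesis using that[of N] 1 by (auto simp: N_def)
qed

lemma face_degree_eq:
  assumes "plane_graph V E"
  shows "face_degree V E f = card (boundary_edges E f) +
    card {e \<in> boundary_edges E f. cut_edge V (end_pairs V E) (e \<inter> V)}"
proof -
  have "finite (boundary_edges E f)" using plane_graph_finite(2)[OF plane_graph_boundary[OF assms]] .
  then have "(\<Sum>e\<in>boundary_edges E f. (if cut_edge V (end_pairs V E) (e \<inter> V) then 1 else 0)) =
    card {e \<in> boundary_edges E f. cut_edge V (end_pairs V E) (e \<inter> V)}"
    by (simp add: sum.If_cases Int_def)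
  moreover have "face_degree V E f = (\<Sum>e\<in>boundary_edges E f. 1 +
      (if cut_edge V (end_pairs V E) (e \<inter> V) then 1 else 0))"
    unfolding face_degree_def by (intro sum.cong) auto
  ultimately show ?thesis by (simp only: sum.distrib) simp
qed

text \<open>Besides three non-bridges, each bridge on the boundary contributes 2, so a single one
  already forces degree 5.\<close>

lemma face_degree_bounds:
  assumes pg: "plane_graph V E" and f: "f \<in> faces V E"
    and e: "e \<in> E" "\<not> cut_edge V (end_pairs V E) (e \<inter> V)"
  shows "face_degree V E f \<ge> 3"
    and "face_degree V E f \<le> 4 \<Longrightarrow> d \<in> boundary_edges E f \<Longrightarrow> \<not> cut_edge V (end_pairs V E) (d \<inter> V)"
    and "face_degree V E f \<le> 4 \<Longrightarrow> card (boundary_edges E f) = face_degree V E f"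
proof -
  let ?B = "boundary_edges E f"
  let ?C = "{e \<in> ?B. cut_edge V (end_pairs V E) (e \<inter> V)}"
  obtain N where N: "N \<subseteq> ?B" "card N \<ge> 3"
    "\<And>e. e \<in> N \<Longrightarrow> \<not> cut_edge V (end_pairs V E) (e \<inter> V)"
    by (rule face_degree_ge3[OF pg f e]) blast
  have fB: "finite ?B" using plane_graph_finite(2)[OF plane_graph_boundary[OF pg]] .
  have "N \<inter> ?C = {}" using N(3) by blast
  then have "card N + card ?C \<le> card ?B"
    using fB N(1) by (subst card_Un_disjoint[symmetric]) (auto intro: card_mono finite_subset)
  then have 1: "face_degree V E f \<ge> 3 + 2 * card ?C" using N(2) face_degree_eq[OF pg, of f] by linarith
  then show "face_degree V E f \<ge> 3" by simp
  assume "face_degree V E f \<le> 4"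
  then have "card ?C = 0" using 1 by linarith
  then have C: "?C = {}" using fB by simp
  then show "d \<in> ?B \<Longrightarrow> \<not> cut_edge V (end_pairs V E) (d \<inter> V)" by blast
  show "card (boundary_edges E f) = face_degree V E f"
    using face_degree_eq[OF pg, of f] unfolding C by simp
qed

section \<open>Uniquely 3-colourable graphs\<close>

lemma chromatic_number_le: "proper_coloring V A k c \<Longrightarrow> chromatic_number V A \<le> k"
  unfolding chromatic_number_def by (rule Least_le) blast

lemma proper_coloring_card:
  assumes "finite V" "simple_on V A"
  obtains c where "proper_coloring V A (card V) c"
proof -
  obtain c where c: "bij_betw c V {0..<card V}" using ex_bij_betw_finite_nat[OF assms(1)] by blast
  have "proper_coloring V A (card V) c" unfolding proper_coloring_def
  proof (intro conjI ballI allI impI)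
    show "c v < card V" if "v \<in> V" for v using bij_betwE[OF c] that by auto
    show "c u \<noteq> c v" if "{u, v} \<in> A" for u v
    proof -
      have "u \<in> V" "v \<in> V" "u \<noteq> v" using assms(2) that unfolding simple_on_def
        by (auto simp: doubleton_eq_iff)
      then show ?thesis using c unfolding bij_betw_def inj_on_def by blast
    qed
  qed
  then show ?thesis by (rule that)
qed

lemma proper_coloring_chromatic:
  assumes "finite V" "simple_on V A"
  obtains c where "proper_coloring V A (chromatic_number V A) c"
proof -
  have "\<exists>k c. proper_coloring V A k c" using proper_coloring_card[OF assms] by metis
  then have "\<exists>c. proper_coloring V A (chromatic_number V A) c"
    unfolding chromatic_number_def by (rule LeastI_ex)
  then show ?thesis using that by blast
qed

text \<open>If the subgraph of two colour classes were disconnected, exchanging the two colours on one of its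
  components would give an essentially different colouring.\<close>

lemma kempe_chain_connected:
  assumes simple: "simple_on V A" and uc: "uniquely_colorable k V A" and c: "proper_coloring V A k c"
    and ij: "i < k" "j < k" "i \<noteq> j" and vw: "v \<in> V" "w \<in> V" "c v \<in> {i, j}" "c w \<in> {i, j}"
  shows "(v, w) \<in> (adj_rel {a \<in> A. c ` a = {i, j}})\<^sup>*"
proof (rule ccontr)
  let ?A = "{a \<in> A. c ` a = {i, j}}"
  assume nvw: "(v, w) \<notin> (adj_rel ?A)\<^sup>*"
  define K where "K = {x. c x \<in> {i, j} \<and> (v, x) \<in> (adj_rel ?A)\<^sup>*}"
  define c' where "c' x = (if x \<in> K then (if c x = i then j else i) else c x)" for x
  have step: "y \<in> K" if "{x, y} \<in> A" "x \<in> K" "c y \<in> {i, j}" for x y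
  proof -
    have "c x \<noteq> c y" using c that(1) unfolding proper_coloring_def by blast
    then have "c ` {x, y} = {i, j}" using that by (auto simp: K_def)
    then have "(x, y) \<in> adj_rel ?A" using that by simp
    then show ?thesis using that unfolding K_def by (auto intro: rtrancl_into_rtrancl)
  qed
  have "proper_coloring V A k c'" unfolding proper_coloring_def
  proof (intro conjI ballI allI impI)
    show "c' x < k" if "x \<in> V" for x
      using c that ij by (auto simp: c'_def proper_coloring_def)
    show "c' x \<noteq> c' y" if xy: "{x, y} \<in> A" for x y
    proof -
      have yx: "{y, x} \<in> A" using xy by (simp add: insert_commute)
      have ne: "c x \<noteq> c y" using c xy unfolding proper_coloring_def by blast
      show ?thesis
        using step[OF xy] step[OF yx] ne ij(3) by (auto simp: c'_def K_def split: if_splits)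
    qed
  qed
  then obtain \<pi> where \<pi>: "\<pi> permutes {..<k}" "\<forall>x\<in>V. c' x = \<pi> (c x)"
    using uc c unfolding uniquely_colorable_def by blast
  have "v \<in> K" "w \<notin> K" using vw nvw by (auto simp: K_def)
  then have "c' v \<noteq> c v" "c' v \<in> {i, j}" "c' w = c w"
    using vw(3) ij(3) by (auto simp: c'_def)
  then have v: "\<pi> (c v) \<noteq> c v" "\<pi> (c v) \<in> {i, j}" and w: "\<pi> (c w) = c w"
    using bspec[OF \<pi>(2) vw(1)] bspec[OF \<pi>(2) vw(2)] by simp_all
  \<comment> \<open>\<open>\<pi>\<close> moves the colour of the recoloured \<open>v\<close> within
    \<open>{i, j}\<close> and fixes that of the untouched \<open>w\<close>. So \<open>w\<close> has
    the other colour, to which \<open>\<pi>\<close> also sends the colour of \<open>v\<close>,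
    against injectivity.\<close>
  have "c w \<noteq> c v" using v w by metis
  then have "\<pi> (c v) = c w" using v vw by auto
  then have "\<pi> (c v) = \<pi> (c w)" using w by simp
  then have "c v = c w" by (rule injD[OF permutes_inj[OF \<pi>(1)]])
  then show False using \<open>c w \<noteq> c v\<close> by simp
qed

text \<open>A connected graph has at most one more vertex than edges. Proving "at most one
  component" instead of "exactly one" also covers empty colour classes.\<close>

lemma kempe_edge_count:
  assumes V: "finite V" and simple: "simple_on V A" and uc: "uniquely_colorable k V A"
    and c: "proper_coloring V A k c" and ij: "i < k" "j < k" "i \<noteq> j"
  shows "card {v \<in> V. c v = i} + card {v \<in> V. c v = j} \<le> card {a \<in> A. c ` a = {i, j}} + 1"
proof -
  let ?A = "{a \<in> A. c ` a = {i, j}}"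
  let ?W = "{v \<in> V. c v \<in> {i, j}}"
  have "simple_on ?W ?A"
    unfolding simple_on_def
  proof
    fix a assume a: "a \<in> ?A"
    then have "a \<in> A" by simp
    then obtain x y where "x \<in> V" "y \<in> V" "x \<noteq> y" "a = {x, y}"
      using simple unfolding simple_on_def by metis
    moreover have "c x \<in> {i, j}" "c y \<in> {i, j}" using a calculation by auto
    ultimately show "\<exists>x\<in>?W. \<exists>y\<in>?W. x \<noteq> y \<and> a = {x, y}" by blast
  qed
  then have "card ?W \<le> card (graph_components ?W ?A) + card ?A"
    using V by (intro card_graph_components_ge) auto
  moreover have "card (graph_components ?W ?A) \<le> 1"
  proof -
    have all: "X = ?W" if X: "X \<in> graph_components ?W ?A" for X
    proof -
      obtain v where v: "v \<in> ?W" "X = {x \<in> ?W. (v, x) \<in> (adj_rel ?A)\<^sup>*}"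
        using X unfolding graph_components_def by (elim imageE) simp
      have "(v, x) \<in> (adj_rel ?A)\<^sup>*" if "x \<in> ?W" for x
        by (rule kempe_chain_connected[OF simple uc c ij]) (use v(1) that in auto)
      then show ?thesis unfolding v(2) by blast
    qed
    have "X = Y" if "X \<in> graph_components ?W ?A" "Y \<in> graph_components ?W ?A" for X Y
      by (rule trans[OF all[OF that(1)] sym[OF all[OF that(2)]]])
    moreover have "finite (graph_components ?W ?A)" using V by (simp add: graph_components_def)
    ultimately show ?thesis by (simp add: card_le_Suc0_iff_eq)
  qed
  moreover have "card ?W = card {v \<in> V. c v = i} + card {v \<in> V. c v = j}"
  proof -
    have "?W = {v \<in> V. c v = i} \<union> {v \<in> V. c v = j}" by blast
    moreover have "{v \<in> V. c v = i} \<inter> {v \<in> V. c v = j} = {}" using ij by blast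
    ultimately show ?thesis using V by (simp add: card_Un_disjoint)
  qed
  ultimately show ?thesis by linarith
qed

text \<open>In the sum of the three bounds of \<open>kempe_edge_count\<close>, each colour class
  occurs twice and each edge at most once. With fewer than three vertices, giving all of them
  different colours would use fewer than three colours.\<close>

lemma uniquely_3_colorable_card:
  assumes V: "finite V" and simple: "simple_on V A" and uc: "uniquely_colorable 3 V A"
  shows "2 * card V \<le> card A + 3" "3 \<le> card V"
proof -
  have chi: "chromatic_number V A = 3" using uc by (simp add: uniquely_colorable_def)
  obtain c where c: "proper_coloring V A 3 c"
    using proper_coloring_chromatic[OF V simple] chi by metis
  obtain d where "proper_coloring V A (card V) d" by (rule proper_coloring_card[OF V simple])
  then show "3 \<le> card V" using chromatic_number_le chi by metis
  define n where "n i = card {v \<in> V. c v = i}" for i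
  define m where "m i j = {a \<in> A. c ` a = {i, j}}" for i j
  have "card V = card ({v \<in> V. c v = 0} \<union> ({v \<in> V. c v = 1} \<union> {v \<in> V. c v = 2}))"
    using c unfolding proper_coloring_def by (intro arg_cong[where f = card]) fastforce
  also have "\<dots> \<le> n 0 + card ({v \<in> V. c v = 1} \<union> {v \<in> V. c v = 2})"
    unfolding n_def by (rule card_Un_le)
  also have "\<dots> \<le> n 0 + (n 1 + n 2)"
    unfolding n_def by (intro add_left_mono card_Un_le)
  finally have "card V \<le> n 0 + (n 1 + n 2)" .
  moreover have "n i + n j \<le> card (m i j) + 1" if "i < 3" "j < 3" "i \<noteq> j" for i j
    unfolding n_def m_def by (rule kempe_edge_count[OF V simple uc c that])
  from this[of 0 1] this[of 0 2] this[of 1 2] have "n 0 + n 1 \<le> card (m 0 1) + 1"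
    "n 0 + n 2 \<le> card (m 0 2) + 1" "n 1 + n 2 \<le> card (m 1 2) + 1" by simp_all
  moreover have "card (m 0 1) + (card (m 0 2) + card (m 1 2)) \<le> card A"
  proof -
    have fA: "finite A" by (rule simple_on_finite[OF simple V])
    have dis: "m 0 1 \<inter> (m 0 2 \<union> m 1 2) = {}" "m 0 2 \<inter> m 1 2 = {}"
    proof -
      have "{0, 1} \<noteq> {0, 2::nat}" "{0, 1} \<noteq> {1, 2::nat}" "{0, 2} \<noteq> {1, 2::nat}"
        by (simp_all add: doubleton_eq_iff)
      then show "m 0 1 \<inter> (m 0 2 \<union> m 1 2) = {}" "m 0 2 \<inter> m 1 2 = {}"
        unfolding m_def by fastforce+
    qed
    have "card (m 0 1 \<union> (m 0 2 \<union> m 1 2)) \<le> card A"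
      by (rule card_mono[OF fA]) (auto simp: m_def)
    moreover have "finite (m i j)" for i j using fA by (simp add: m_def)
    ultimately show ?thesis using dis by (simp add: card_Un_disjoint)
  qed
  ultimately show "2 * card V \<le> card A + 3" by linarith
qed

text \<open>Discharging: every triangular face receives \<open>1/3\<close> from each of its three neighbours. Their degree \<open>d\<close>
  is at least \<open>6\<close>, so that \<open>d - 4 \<ge> d / 3\<close> and all charges \<open>d - 4\<close> become nonnegative.\<close>

lemma discharging:
  assumes pg: "plane_graph V E" and d: "d \<in> E" "\<not> cut_edge V (end_pairs V E) (d \<inter> V)"
    and no: "\<And>k. k \<le> 5 \<Longrightarrow> \<not> has_adjacent_faces V E 3 k"
  shows "4 * card (faces V E) \<le> 2 * card E"
proof -
  let ?F = "faces V E" and ?deg = "face_degree V E" and ?B = "boundary_edges E"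
  define T where "T = {f \<in> ?F. ?deg f = 3}"
  define Q where "Q = {f \<in> ?F. 6 \<le> ?deg f}"
  define R where "R = ?F - T - Q"
  define X where "X = (\<Union>f\<in>T. ?B f)"
  have fin: "finite ?F" "finite T" "finite Q" "finite R" "finite X"
    using finite_faces[OF pg] plane_graph_finite(2)[OF plane_graph_boundary[OF pg]]
    by (auto simp: T_def Q_def R_def X_def)
  have fB: "finite (?B f)" for f using plane_graph_finite(2)[OF plane_graph_boundary[OF pg]] .
  have nbr: "6 \<le> ?deg f'" if "f \<in> T" "f' \<in> ?F" "f' \<noteq> f" "e \<in> ?B f" "e \<in> ?B f'" for e f f'
  proof (rule ccontr)
    assume "\<not> 6 \<le> ?deg f'"
    then have "?deg f' \<le> 5" by simp
    moreover have "has_adjacent_faces V E 3 (?deg f')"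
      unfolding has_adjacent_faces_def using that by (auto simp: T_def)
    ultimately show False using no by blast
  qed
  \<comment> \<open>Triangles have disjoint boundaries, since two of them sharing an edge would be
    adjacent (3,3)-faces.\<close>
  have "card X = (\<Sum>f\<in>T. card (?B f))" unfolding X_def
  proof (rule card_UN_disjoint[OF fin(2)])
    show "\<forall>f\<in>T. finite (?B f)" using fB by blast
    show "\<forall>f\<in>T. \<forall>f'\<in>T. f \<noteq> f' \<longrightarrow> ?B f \<inter> ?B f' = {}"
    proof (intro ballI impI)
      fix f f' assume "f \<in> T" "f' \<in> T" "f \<noteq> f'"
      then show "?B f \<inter> ?B f' = {}" using nbr[of f f'] by (auto simp: T_def)
    qed
  qed
  also have "\<dots> = (\<Sum>f\<in>T. 3)"
    by (rule sum.cong) (use face_degree_bounds(3)[OF pg _ d] in \<open>auto simp: T_def\<close>)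
  finally have cX: "card X = 3 * card T" by simp
  \<comment> \<open>An edge of a triangle is no bridge, so a second face lies at it, and this face
    has degree at least 6.\<close>
  have "X \<subseteq> (\<Union>f\<in>Q. ?B f)"
  proof
    fix e assume "e \<in> X"
    then obtain f where f: "f \<in> T" "e \<in> ?B f" by (auto simp: X_def)
    then have fF: "f \<in> ?F" and deg: "?deg f \<le> 4" and e: "e \<in> E" by (auto simp: T_def boundary_edges_def)
    have nc: "\<not> cut_edge V (end_pairs V E) (e \<inter> V)"
      by (rule face_degree_bounds(2)[OF pg fF d deg f(2)])
    obtain F1 F2 where "F1 \<in> ?F" "F2 \<in> ?F" "F1 \<noteq> F2" "e \<subseteq> frontier F1" "e \<subseteq> frontier F2"
      by (rule faces_at_noncut[OF pg e nc])
    then obtain f' where f': "f' \<in> ?F" "f' \<noteq> f" "e \<in> ?B f'"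
      using e unfolding boundary_edges_def by blast
    then have "f' \<in> Q" using nbr[OF f(1) f'(1,2) f(2) f'(3)] by (simp add: Q_def)
    then show "e \<in> (\<Union>f\<in>Q. ?B f)" using f' by blast
  qed
  then have "card X \<le> card (\<Union>f\<in>Q. ?B f)" using fin fB by (intro card_mono) auto
  also have "\<dots> \<le> (\<Sum>f\<in>Q. card (?B f))" by (rule card_UN_le[OF fin(3)])
  also have "\<dots> \<le> (\<Sum>f\<in>Q. ?deg f)"
    by (rule sum_mono) (simp add: face_degree_eq[OF pg])
  finally have 1: "3 * card T \<le> (\<Sum>f\<in>Q. ?deg f)" using cX by simp
  have 2: "6 * card Q \<le> (\<Sum>f\<in>Q. ?deg f)"
    using sum_mono[of Q "\<lambda>_. 6" ?deg] by (simp add: Q_def mult.commute)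
  have 3: "4 * card R \<le> (\<Sum>f\<in>R. ?deg f)"
  proof -
    have "4 \<le> ?deg f" if "f \<in> R" for f
      using face_degree_bounds(1)[OF pg _ d, of f] that unfolding R_def T_def by (simp, linarith)
    then show ?thesis using sum_mono[of R "\<lambda>_. 4" ?deg] by (simp add: mult.commute)
  qed
  have FU: "?F = T \<union> (Q \<union> R)" and dis: "T \<inter> (Q \<union> R) = {}" "Q \<inter> R = {}"
    by (auto simp: T_def Q_def R_def)
  have cF: "card ?F = card T + (card Q + card R)"
    unfolding FU using dis fin by (simp add: card_Un_disjoint)
  have "sum ?deg ?F = sum ?deg T + (sum ?deg Q + sum ?deg R)"
    unfolding FU using dis fin by (simp add: sum.union_disjoint)
  moreover have "sum ?deg T = 3 * card T" by (simp add: T_def)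
  \<comment> \<open>Discharging without fractions: with s the degree sum over \<open>Q\<close>,
    \<open>card T\<close> is at most s/3 and \<open>4 * card Q\<close> at most 2s/3, so the surplus
    on \<open>Q\<close> covers the deficit 1 of each triangle.\<close>
  ultimately show ?thesis using sum_face_degree[OF pg] 1 2 3 cF by linarith
qed

lemma adjacent_triangle:
  assumes pg: "plane_graph V E" and uc: "uniquely_colorable 3 V (end_pairs V E)"
  shows "\<exists>k\<le>5. has_adjacent_faces V E 3 k"
proof (rule ccontr)
  assume no: "\<not> ?thesis"
  let ?c = "card (graph_components V (end_pairs V E))"
  note n = uniquely_3_colorable_card[OF plane_graph_finite(1)[OF pg] plane_graph_simple[OF pg] uc,
      unfolded card_end_pairs[OF pg]]
  have euler: "card (faces V E) + card V = card E + ?c + 1" by (rule card_faces[OF pg])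
  have "?c \<noteq> 0"
    using n(2) plane_graph_finite(1)[OF pg] by (auto simp: graph_components_def)
  then have c: "?c \<ge> 1" by simp
  \<comment> \<open>For a forest, Euler's formula with one face gives V = E + c, and 2V \<le> E + 3
    would leave at most two vertices.\<close>
  obtain d where d: "d \<in> E" "\<not> cut_edge V (end_pairs V E) (d \<inter> V)"
  proof (rule ccontr)
    assume "\<not> thesis"
    then have "faces V E = {- skeleton V E}" using that faces_all_cut[OF pg] by metis
    then have "card (faces V E) = 1" by simp
    then show False using euler n c by linarith
  qed
  have "4 * card (faces V E) \<le> 2 * card E"
    by (rule discharging[OF pg d]) (use no in blast)
  then show False using euler n c by linarith
qed

section \<open>Straight-line drawings\<close>

text \<open>Twice the signed area of the triangle \<open>a\<close>, \<open>b\<close>,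
  \<open>c\<close>; the sign tells on which side of the line through \<open>a\<close> and
  \<open>b\<close> the point \<open>c\<close> lies.\<close>

definition cross :: "complex \<Rightarrow> complex \<Rightarrow> complex \<Rightarrow> real" where
  "cross a b c = (Re b - Re a) * (Im c - Im a) - (Im b - Im a) * (Re c - Re a)"

lemma cross_convex_combination:
  "cross a b ((1 - u) *\<^sub>R c + u *\<^sub>R d) = (1 - u) * cross a b c + u * cross a b d"
  by (simp add: cross_def algebra_simps)

lemma cross_ends [simp]: "cross a b a = 0" "cross a b b = 0"
  by (simp_all add: cross_def)

lemma cross_closed_segment: "x \<in> closed_segment a b \<Longrightarrow> cross a b x = 0"
  by (auto simp: in_segment cross_convex_combination)

text \<open>\<open>cross\<close> is affine in its third argument: a common strict sign at
  \<open>c\<close> and \<open>d\<close> persists between them, while the value is 0 between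
  \<open>a\<close> and \<open>b\<close>.\<close>

lemma closed_segments_disjoint:
  assumes "cross a b c * cross a b d > 0"
  shows "closed_segment a b \<inter> closed_segment c d = {}"
proof -
  have "cross a b x \<noteq> 0" if "x \<in> closed_segment c d" for x
  proof -
    from that obtain u where u: "0 \<le> u" "u \<le> 1" and x: "x = (1 - u) *\<^sub>R c + u *\<^sub>R d"
      unfolding in_segment by blast
    have eq: "cross a b x = (1 - u) * cross a b c + u * cross a b d"
      unfolding x by (rule cross_convex_combination)
    consider "cross a b c > 0" "cross a b d > 0" | "cross a b c < 0" "cross a b d < 0"
      using assms by (auto simp: zero_less_mult_iff)
    moreover have pos: "0 < (1 - u) * y + u * z" if "0 < y" "0 < z" for y z :: real
      using u that by (cases "u = 0") (auto intro!: add_nonneg_pos)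
    ultimately show ?thesis
    proof cases
      case 1
      then show ?thesis using pos[OF 1] unfolding eq by linarith
    next
      case 2
      then have "0 < (1 - u) * (- cross a b c) + u * (- cross a b d)" by (intro pos) simp_all
      also have "\<dots> = - cross a b x" unfolding eq by (simp add: algebra_simps)
      finally show ?thesis by simp
    qed
  qed
  then show ?thesis using cross_closed_segment by blast
qed

lemma closed_segments_common_end:
  assumes "cross a b c \<noteq> 0"
  shows "closed_segment a b \<inter> closed_segment a c = {a}"
proof -
  have "x = a" if ab: "x \<in> closed_segment a b" and ac: "x \<in> closed_segment a c" for x
  proof -
    obtain u where x: "x = (1 - u) *\<^sub>R a + u *\<^sub>R c" using ac unfolding in_segment by blast
    have "u * cross a b c = 0"
      using cross_closed_segment[OF ab] unfolding x cross_convex_combination by simp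
    then show ?thesis using assms x by simp
  qed
  then show ?thesis by auto
qed

section \<open>Drawings with integer coordinates\<close>

abbreviation pt :: "int \<times> int \<Rightarrow> complex" where
  "pt p \<equiv> Complex (of_int (fst p)) (of_int (snd p))"

abbreviation seg :: "(int \<times> int) \<times> (int \<times> int) \<Rightarrow> complex set" where
  "seg e \<equiv> closed_segment (pt (fst e)) (pt (snd e))"

definition icross :: "int \<times> int \<Rightarrow> int \<times> int \<Rightarrow> int \<times> int \<Rightarrow> int" where
  "icross a b c = (fst b - fst a) * (snd c - snd a) - (snd b - snd a) * (fst c - fst a)"

text \<open>One segment lies strictly on one side of the line through the other: only sufficient for
  disjointness, but decidable over the integers.\<close>

definition separated :: "(int \<times> int) \<times> (int \<times> int) \<Rightarrow> (int \<times> int) \<times> (int \<times> int) \<Rightarrow> bool" where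
  "separated e d \<longleftrightarrow>
     icross (fst e) (snd e) (fst d) * icross (fst e) (snd e) (snd d) > 0 \<or>
     icross (fst d) (snd d) (fst e) * icross (fst d) (snd d) (snd e) > 0"

definition midpt :: "(int \<times> int) \<times> (int \<times> int) \<Rightarrow> int \<times> int" where
  "midpt e = ((fst (fst e) + fst (snd e)) div 2, (snd (fst e) + snd (snd e)) div 2)"

lemma pt_inj: "pt a = pt b \<longleftrightarrow> a = b"
  by (auto simp: prod_eq_iff)

lemma cross_pt: "cross (pt a) (pt b) (pt c) = of_int (icross a b c)"
  by (simp add: cross_def icross_def)

lemma separated_disjoint:
  assumes "separated e d" shows "seg e \<inter> seg d = {}"
proof -
  have "cross (pt (fst e)) (pt (snd e)) (pt (fst d)) * cross (pt (fst e)) (pt (snd e)) (pt (snd d)) > 0 \<or>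
    cross (pt (fst d)) (pt (snd d)) (pt (fst e)) * cross (pt (fst d)) (pt (snd d)) (pt (snd e)) > 0"
    using assms unfolding separated_def cross_pt by (simp flip: of_int_mult)
  then show ?thesis using closed_segments_disjoint by (metis Int_commute)
qed

text \<open>The first clause excludes isolated vertices, so that the edges cover the skeleton. Edges
  sharing one end cannot overlap, as no other vertex lies on the line of an edge. An edge listed in
  both directions satisfies none of the alternatives.\<close>

definition straight_drawing ::
    "(int \<times> int) list \<Rightarrow> ((int \<times> int) \<times> (int \<times> int)) list \<Rightarrow> bool" where
  "straight_drawing vs es \<longleftrightarrow>
     list_all (\<lambda>w. list_ex (\<lambda>(a, b). w = a \<or> w = b) es) vs \<and>
     list_all (\<lambda>(a, b). a \<noteq> b \<and> List.member vs a \<and> List.member vs b \<and>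
       list_all (\<lambda>w. w = a \<or> w = b \<or> icross a b w \<noteq> 0) vs \<and>
       list_all (\<lambda>(c, d). (a, b) = (c, d) \<or> (a = c \<and> b \<noteq> d) \<or> (a \<noteq> c \<and> b = d) \<or>
         (a = d \<and> b \<noteq> c) \<or> (a \<noteq> d \<and> b = c) \<or> separated (a, b) (c, d)) es) es"

lemma straight_drawingD:
  assumes "straight_drawing vs es"
  shows "w \<in> set vs \<Longrightarrow> \<exists>(a, b)\<in>set es. w = a \<or> w = b"
    and "(a, b) \<in> set es \<Longrightarrow> a \<noteq> b \<and> a \<in> set vs \<and> b \<in> set vs"
    and "(a, b) \<in> set es \<Longrightarrow> w \<in> set vs \<Longrightarrow> w \<noteq> a \<Longrightarrow> w \<noteq> b \<Longrightarrow> icross a b w \<noteq> 0"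
    and "(a, b) \<in> set es \<Longrightarrow> (c, d) \<in> set es \<Longrightarrow> (a, b) \<noteq> (c, d) \<Longrightarrow>
      (a = c \<and> b \<noteq> d) \<or> (a \<noteq> c \<and> b = d) \<or> (a = d \<and> b \<noteq> c) \<or> (a \<noteq> d \<and> b = c) \<or> separated (a, b) (c, d)"
  using assms unfolding straight_drawing_def list_all_iff list_ex_iff List.member_iff by fastforce+

lemma seg_vertices:
  assumes dr: "straight_drawing vs es" and e: "(a, b) \<in> set es"
  shows "seg (a, b) \<inter> pt ` set vs = {pt a, pt b}"
proof -
  have "w = a \<or> w = b" if "w \<in> set vs" "pt w \<in> seg (a, b)" for w
  proof (rule ccontr)
    assume "\<not> ?thesis"
    then have "icross a b w \<noteq> 0" using straight_drawingD(3)[OF dr e that(1)] by blast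
    moreover have "cross (pt a) (pt b) (pt w) = 0" using cross_closed_segment that(2) by simp
    ultimately show False unfolding cross_pt by simp
  qed
  moreover have "a \<in> set vs" "b \<in> set vs" using straight_drawingD(2)[OF dr e] by blast+
  ultimately show ?thesis by auto
qed

lemma seg_common_end:
  assumes "icross a b c \<noteq> 0" "a \<in> set vs" shows "seg (a, b) \<inter> seg (a, c) \<subseteq> pt ` set vs"
  using closed_segments_common_end[of "pt a" "pt b" "pt c"] assms unfolding cross_pt by simp

lemma seg_swap: "seg (a, b) = seg (b, a)"
  by (simp add: closed_segment_commute)

lemma icross_swap: "icross b a c = - icross a b c"
  by (simp add: icross_def algebra_simps)

lemma seg_crossing:
  assumes dr: "straight_drawing vs es" and e: "e \<in> set es" "d \<in> set es" "e \<noteq> d"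
  shows "seg e \<inter> seg d \<subseteq> pt ` set vs"
proof -
  obtain a b where ab: "e = (a, b)" by (cases e)
  obtain c c' where cd: "d = (c, c')" by (cases d)
  note ab_props = straight_drawingD(2)[OF dr e(1)[unfolded ab]]
  note cd_props = straight_drawingD(2)[OF dr e(2)[unfolded cd]]
  note nz = straight_drawingD(3)[OF dr e(1)[unfolded ab]]
  consider "a = c" "b \<noteq> c'" | "a \<noteq> c" "b = c'" | "a = c'" "b \<noteq> c" | "a \<noteq> c'" "b = c" | "separated e d"
    using straight_drawingD(4)[OF dr e(1)[unfolded ab] e(2)[unfolded cd]] e(3) ab cd by blast
  then show ?thesis
  proof cases
    case 1
    have "icross a b c' \<noteq> 0" using nz cd_props 1 by metis
    then show ?thesis unfolding ab cd 1(1)[symmetric] using ab_props by (intro seg_common_end) auto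
  next
    case 2
    have "icross b a c \<noteq> 0" using nz[of c] cd_props 2 icross_swap[of a b c] by simp
    then show ?thesis unfolding ab cd 2(2)[symmetric] seg_swap[of a b] seg_swap[of c b]
      using ab_props by (intro seg_common_end) auto
  next
    case 3
    have "icross a b c \<noteq> 0" using nz[of c] cd_props 3 by simp
    then show ?thesis unfolding ab cd 3(1)[symmetric] seg_swap[of c a]
      using ab_props by (intro seg_common_end) auto
  next
    case 4
    have "icross b a c' \<noteq> 0" using nz[of c'] cd_props 4 icross_swap[of a b c'] by force
    then show ?thesis unfolding ab cd 4(2)[symmetric] seg_swap[of a b]
      using ab_props by (intro seg_common_end) auto
  next
    case 5
    then show ?thesis using separated_disjoint by blast
  qed
qed

lemma seg_ends_inj:
  assumes dr: "straight_drawing vs es" and e: "e \<in> set es" "d \<in> set es"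
    and eq: "seg e \<inter> pt ` set vs = seg d \<inter> pt ` set vs"
  shows "e = d"
proof (rule ccontr)
  assume ne: "e \<noteq> d"
  obtain a b where ab: "e = (a, b)" by (cases e)
  obtain c c' where cd: "d = (c, c')" by (cases d)
  have "{pt a, pt b} = {pt c, pt c'}"
    using eq seg_vertices[OF dr e(1)[unfolded ab]] seg_vertices[OF dr e(2)[unfolded cd]] ab cd by simp
  then have same: "{a, b} = {c, c'}" by (simp only: doubleton_eq_iff pt_inj)
  \<comment> \<open>Equal sets of ends rule out every alternative with exactly one common end; what
    remains is impossible for segments with a common point.\<close>
  have "separated (a, b) (c, c')"
    using straight_drawingD(4)[OF dr e(1)[unfolded ab] e(2)[unfolded cd]] ne ab cd same
    by (auto simp: doubleton_eq_iff)
  then have "seg e \<inter> seg d = {}" using separated_disjoint ab cd by blast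
  moreover have V: "pt a \<in> seg e \<inter> pt ` set vs"
    unfolding ab seg_vertices[OF dr e(1)[unfolded ab]] by simp
  moreover have "pt a \<in> seg d \<inter> pt ` set vs" using V unfolding eq .
  ultimately show False by blast
qed

lemma plane_graph_straight:
  assumes dr: "straight_drawing vs es"
  shows "plane_graph (pt ` set vs) (seg ` set es)"
  unfolding plane_graph_def
proof (intro conjI)
  show "\<forall>e\<in>seg ` set es. \<exists>g. arc g \<and> path_image g = e \<and> e \<inter> pt ` set vs = {pathstart g, pathfinish g}"
  proof
    fix e assume "e \<in> seg ` set es"
    then obtain a b where ab: "(a, b) \<in> set es" "e = seg (a, b)" by auto
    have "arc (linepath (pt a) (pt b))"
      using straight_drawingD(2)[OF dr ab(1)] pt_inj by (intro arc_linepath) metis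
    then show "\<exists>g. arc g \<and> path_image g = e \<and> e \<inter> pt ` set vs = {pathstart g, pathfinish g}"
      using seg_vertices[OF dr ab(1)] ab(2) by (intro exI[of _ "linepath (pt a) (pt b)"]) simp
  qed
  show "\<forall>e\<in>seg ` set es. \<forall>e'\<in>seg ` set es. e \<noteq> e' \<longrightarrow> e \<inter> e' \<subseteq> pt ` set vs"
    using seg_crossing[OF dr] by fastforce
  show "inj_on (\<lambda>e. e \<inter> pt ` set vs) (seg ` set es)"
    unfolding inj_on_def using seg_ends_inj[OF dr] by fastforce
qed auto

section \<open>Recognising faces by visibility\<close>

text \<open>The segment from \<open>p\<close> to \<open>m\<close> without \<open>m\<close> is
  connected and avoids the skeleton, so it stays in the face of \<open>p\<close>, and
  \<open>m\<close> lies in the closure. One face serves all edges seen from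
  \<open>p\<close>.\<close>

lemma face_visible:
  assumes pg: "plane_graph V E" and p: "p \<notin> skeleton V E"
  obtains f where "f \<in> faces V E"
    "\<forall>e\<in>E. \<forall>m\<in>e - V. closed_segment p m \<inter> skeleton V E \<subseteq> {m} \<longrightarrow> e \<in> boundary_edges E f"
proof -
  define f where "f = connected_component_set (- skeleton V E) p"
  have f: "f \<in> faces V E" unfolding faces_def f_def components_def using p by blast
  have "e \<in> boundary_edges E f" if em: "e \<in> E" "m \<in> e - V" "closed_segment p m \<inter> skeleton V E \<subseteq> {m}" for e m
  proof (rule boundary_edgeI[OF pg em(1) f])
    let ?S = "insert p (open_segment p m)"
    have pm: "p \<noteq> m" using p em(1,2) by blast
    have cl: "closure (open_segment p m) = closed_segment p m" using pm by simp
    have "connected ?S"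
    proof (rule connected_intermediate_closure)
      show "connected (open_segment p m)" by (intro convex_connected convex_open_segment)
      show "?S \<subseteq> closure (open_segment p m)" unfolding cl by (auto simp: open_segment_def)
    qed auto
    moreover have "?S \<subseteq> - skeleton V E"
      using em(3) p by (auto simp: open_segment_def)
    ultimately have "?S \<subseteq> f" unfolding f_def by (intro connected_component_maximal) auto
    then have "closed_segment p m \<subseteq> closure f" using cl closure_mono[of "open_segment p m" f] by blast
    then have "m \<in> closure f" by (meson ends_in_segment(2) subsetD)
    then show "closure f \<inter> (e - V) \<noteq> {}" using em(2) by blast
  qed
  then show ?thesis using that[OF f] by blast
qed

text \<open>The certificate \<open>(p, D)\<close> for a face: all midpoints of the edges in \<open>D\<close> can be seen from \<open>p\<close>. As edges end in
  points with even coordinates, their midpoints are integral.\<close>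

definition sees :: "((int \<times> int) \<times> (int \<times> int)) list \<Rightarrow>
    (int \<times> int) \<times> ((int \<times> int) \<times> (int \<times> int)) list \<Rightarrow> bool" where
  "sees es F \<longleftrightarrow> list_all (\<lambda>e. List.member es e \<and> icross (fst e) (snd e) (fst F) \<noteq> 0 \<and>
     even (fst (fst e) + fst (snd e)) \<and> even (snd (fst e) + snd (snd e)) \<and>
     list_all (\<lambda>d. d = e \<or> separated (fst F, midpt e) d) es) (snd F)"

lemma sees_boundary:
  assumes dr: "straight_drawing vs es" and see: "sees es (p, D)" and D: "D \<noteq> []"
  obtains f where "f \<in> faces (pt ` set vs) (seg ` set es)"
    "seg ` set D \<subseteq> boundary_edges (seg ` set es) f"
proof -
  let ?V = "pt ` set vs" and ?E = "seg ` set es"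
  have s: "e \<in> set es" "icross (fst e) (snd e) p \<noteq> 0" "even (fst (fst e) + fst (snd e))"
    "even (snd (fst e) + snd (snd e))" "\<And>d. d \<in> set es \<Longrightarrow> d \<noteq> e \<Longrightarrow> separated (p, midpt e) d"
    if "e \<in> set D" for e
    using see that unfolding sees_def list_all_iff List.member_iff by auto
  have skel: "skeleton ?V ?E = \<Union>?E"
  proof -
    have "pt w \<in> \<Union>?E" if w: "w \<in> set vs" for w
    proof -
      obtain a b where "(a, b) \<in> set es" "w = a \<or> w = b" using straight_drawingD(1)[OF dr w] by blast
      then show ?thesis by (auto intro!: bexI[of _ "(a, b)"])
    qed
    then show ?thesis by blast
  qed
  have mid: "pt (midpt e) = midpoint (pt (fst e)) (pt (snd e))" if e: "e \<in> set D" for e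
    using s(3,4)[OF e] by (auto simp: midpt_def midpoint_def complex_eq_iff real_of_int_div)
  have vis: "closed_segment (pt p) (pt (midpt e)) \<inter> \<Union>?E \<subseteq> {pt (midpt e)}" if e: "e \<in> set D" for e
  proof -
    have "seg (p, midpt e) \<inter> seg d = {}" if "d \<in> set es" "d \<noteq> e" for d
      using separated_disjoint s(5)[OF e that] by blast
    \<comment> \<open>As \<open>p\<close> is off the line through \<open>e\<close>, the line of
      sight meets this line only at its end.\<close>
    moreover have "x = pt (midpt e)" if x: "x \<in> seg (p, midpt e)" "x \<in> seg e" for x
    proof -
      obtain u where xu: "x = (1 - u) *\<^sub>R pt p + u *\<^sub>R pt (midpt e)"
        using x(1) unfolding in_segment fst_conv snd_conv by blast
      have "pt (midpt e) \<in> seg e" using mid[OF e] by simp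
      then have "cross (pt (fst e)) (pt (snd e)) (pt (midpt e)) = 0" by (rule cross_closed_segment)
      then have "(1 - u) * cross (pt (fst e)) (pt (snd e)) (pt p) = 0"
        using cross_closed_segment[OF x(2)] unfolding xu cross_convex_combination by simp
      then have "u = 1" using s(2)[OF e] unfolding cross_pt by simp
      then show ?thesis using xu by simp
    qed
    ultimately show ?thesis by fastforce
  qed
  \<comment> \<open>On an edge, \<open>p\<close> would have to coincide with a midpoint that it
    sees, contrary to being off the line of that edge. This uses that \<open>D\<close> is not
    empty.\<close>
  have pE: "pt p \<notin> \<Union>?E"
  proof
    assume "pt p \<in> \<Union>?E"
    moreover obtain e where e: "e \<in> set D" using D by (cases D) auto
    ultimately have "pt p = pt (midpt e)" using vis[OF e] by auto
    then have "pt p \<in> seg e" using mid[OF e] by simp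
    then have "cross (pt (fst e)) (pt (snd e)) (pt p) = 0" by (rule cross_closed_segment)
    then show False using s(2)[OF e] unfolding cross_pt by simp
  qed
  have pE': "pt p \<notin> skeleton ?V ?E" unfolding skel by (rule pE)
  obtain f where f: "f \<in> faces ?V ?E"
    "\<forall>e\<in>?E. \<forall>m\<in>e - ?V. closed_segment (pt p) m \<inter> skeleton ?V ?E \<subseteq> {m} \<longrightarrow>
      e \<in> boundary_edges ?E f"
    by (rule face_visible[OF plane_graph_straight[OF dr] pE'])
  have "seg e \<in> boundary_edges ?E f" if e: "e \<in> set D" for e
  proof (rule f(2)[rule_format])
    show "seg e \<in> ?E" using s(1)[OF e] by blast
    obtain a b where ab: "e = (a, b)" by (cases e)
    have "a \<noteq> b" using straight_drawingD(2)[OF dr] s(1)[OF e] ab by blast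
    then have "pt a \<noteq> pt b" using pt_inj by metis
    then have "pt (midpt e) \<notin> {pt a, pt b}"
      unfolding ab mid[OF e, unfolded ab] fst_conv snd_conv insert_iff empty_iff midpoint_eq_endpoint by metis
    moreover have "pt (midpt e) \<in> seg e" using mid[OF e] by simp
    moreover have "seg e \<inter> ?V = {pt a, pt b}"
      unfolding ab by (rule seg_vertices[OF dr s(1)[OF e, unfolded ab]])
    ultimately show "pt (midpt e) \<in> seg e - ?V" by blast
    show "closed_segment (pt p) (pt (midpt e)) \<inter> skeleton ?V ?E \<subseteq> {pt (midpt e)}"
      unfolding skel by (rule vis[OF e])
  qed
  then show ?thesis using that[OF f(1)] by blast
qed

text \<open>Large faces are measured by their number of boundary edges, because a visibility
  certificate yields distinct edges and not an exact degree.\<close>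

lemma no_small_adjacent_faces:
  assumes pg: "plane_graph V E"
    and big: "\<And>e. e \<in> E \<Longrightarrow> \<exists>f\<in>faces V E. e \<in> boundary_edges E f \<and> 5 \<le> card (boundary_edges E f)"
    and k: "i \<le> 4" "k \<le> 4"
  shows "\<not> has_adjacent_faces V E i k"
proof
  assume "has_adjacent_faces V E i k"
  then obtain f1 f2 e where f: "f1 \<in> faces V E" "f2 \<in> faces V E" "f1 \<noteq> f2"
    "face_degree V E f1 = i" "face_degree V E f2 = k" "e \<in> boundary_edges E f1" "e \<in> boundary_edges E f2"
    unfolding has_adjacent_faces_def by blast
  have e: "e \<in> E" using f(6) by (simp add: boundary_edges_def)
  then obtain g where g: "g \<in> faces V E" "e \<in> boundary_edges E g" "5 \<le> card (boundary_edges E g)"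
    using big by blast
  then have "5 \<le> face_degree V E g" using face_degree_eq[OF pg, of g] by simp
  then have "g \<noteq> f1" "g \<noteq> f2" using f k by auto
  then have "card {f1, f2, g} = 3" using f(3) by simp
  moreover have "card {f1, f2, g} \<le> card {f \<in> faces V E. e \<in> boundary_edges E f}"
    using f g finite_faces[OF pg] by (intro card_mono) auto
  ultimately show False using card_faces_at[OF pg e] by (simp split: if_splits)
qed

lemma no_small_adjacent_straight:
  assumes dr: "straight_drawing vs es"
    and see: "list_all (\<lambda>F. sees es F \<and> distinct (snd F) \<and> 5 \<le> length (snd F)) Fs"
    and cover: "list_all (\<lambda>e. list_ex (\<lambda>F. List.member (snd F) e) Fs) es"
    and k: "i \<le> 4" "k \<le> 4"
  shows "\<not> has_adjacent_faces (pt ` set vs) (seg ` set es) i k"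
proof (rule no_small_adjacent_faces[OF plane_graph_straight[OF dr] _ k])
  let ?V = "pt ` set vs" and ?E = "seg ` set es"
  fix e' assume "e' \<in> ?E"
  then obtain e where e: "e \<in> set es" "e' = seg e" by blast
  then obtain p D where F: "(p, D) \<in> set Fs" "e \<in> set D"
    using cover unfolding list_all_iff list_ex_iff List.member_iff by fastforce
  then have D: "sees es (p, D)" "distinct D" "5 \<le> length D" using see unfolding list_all_iff by auto
  then have "D \<noteq> []" by auto
  then obtain f where f: "f \<in> faces ?V ?E" "seg ` set D \<subseteq> boundary_edges ?E f"
    using sees_boundary[OF dr D(1)] by blast
  have "set D \<subseteq> set es" using D(1) unfolding sees_def list_all_iff List.member_iff by auto
  then have "inj_on seg (set D)"
    by (intro inj_onI seg_ends_inj[OF dr]) (auto simp only:)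
  then have "5 \<le> card (seg ` set D)" using D by (simp add: card_image distinct_card)
  also have "\<dots> \<le> card (boundary_edges ?E f)"
    using f(2) by (intro card_mono) (auto simp: boundary_edges_def)
  finally show "\<exists>f\<in>faces ?V ?E. e' \<in> boundary_edges ?E f \<and> 5 \<le> card (boundary_edges ?E f)"
    using f e F(2) by blast
qed

section \<open>A plane graph whose triangles have only pentagonal neighbours\<close>

text \<open>The graph was found by a computer search and drawn so that each of its four pentagonal faces is star-shaped;
  the faces not listed among the pentagons are triangles, and every edge lies on a pentagon.\<close>

definition vertex :: "nat \<Rightarrow> int \<times> int" where
  "vertex i = [(10, 6), (16, 6), (16, 10), (2, 4), (16, 20), (12, 10), (10, 10), (12, 12), (18, 12),
     (22, 4), (18, 10)] ! i"

text \<open>These 19 edges on 11 vertices attain the bound 2 * 11 - 3 of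
  \<open>uniquely_3_colorable_card\<close>. Euler's formula gives 10 faces, and four pentagons and
  six triangles make up the degree sum 38.\<close>

definition edge_list :: "(nat \<times> nat) list" where
  "edge_list = [(0, 1), (0, 5), (0, 7), (0, 9), (1, 9), (2, 7), (2, 8), (3, 4), (3, 6), (3, 7), (3, 9),
     (4, 9), (5, 7), (6, 7), (7, 8), (7, 9), (8, 9), (8, 10), (9, 10)]"

definition drawn_vertices :: "(int \<times> int) list" where
  "drawn_vertices = map vertex [0..<11]"

definition drawn_edges :: "((int \<times> int) \<times> (int \<times> int)) list" where
  "drawn_edges = map (\<lambda>(i, j). (vertex i, vertex j)) edge_list"

text \<open>The outer face is the triangle 3, 4, 9, so every certified face is bounded and its point
  can be chosen inside the polygon.\<close>

definition pentagons :: "((int \<times> int) \<times> ((int \<times> int) \<times> (int \<times> int)) list) list" where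
  "pentagons = map (\<lambda>(p, D). (p, map (\<lambda>(i, j). (vertex i, vertex j)) D))
     [((7, 6), [(0, 9), (3, 9), (3, 6), (6, 7), (0, 7)]),
      ((15, 7), [(0, 5), (5, 7), (7, 9), (1, 9), (0, 1)]),
      ((16, 9), [(2, 8), (8, 10), (9, 10), (7, 9), (2, 7)]),
      ((16, 17), [(3, 4), (4, 9), (8, 9), (7, 8), (3, 7)])]"

lemma straight_drawing_example: "straight_drawing drawn_vertices drawn_edges"
  by code_simp

lemma pentagons_seen:
  "list_all (\<lambda>F. sees drawn_edges F \<and> distinct (snd F) \<and> 5 \<le> length (snd F)) pentagons"
  by code_simp

lemma pentagons_cover:
  "list_all (\<lambda>e. list_ex (\<lambda>F. List.member (snd F) e) pentagons) drawn_edges"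
  by code_simp

abbreviation example_vertices :: "complex set" where
  "example_vertices \<equiv> pt ` set drawn_vertices"

abbreviation example_edges :: "complex set set" where
  "example_edges \<equiv> seg ` set drawn_edges"

lemma example_vertices_eq: "example_vertices = (\<lambda>i. pt (vertex i)) ` {..<11}"
  by (auto simp: drawn_vertices_def)

lemma vertex_inj: "i < 11 \<Longrightarrow> j < 11 \<Longrightarrow> vertex i = vertex j \<Longrightarrow> i = j"
proof -
  have "distinct (map vertex [0..<11])" by code_simp
  then have "inj_on vertex {0..<11}" by (simp add: distinct_map)
  then show "i < 11 \<Longrightarrow> j < 11 \<Longrightarrow> vertex i = vertex j \<Longrightarrow> i = j" by (simp add: inj_on_def)
qed

lemma example_end_pairs:
  "end_pairs example_vertices example_edges =
     (\<lambda>(i, j). {pt (vertex i), pt (vertex j)}) ` set edge_list"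
proof -
  have "seg (a, b) \<inter> example_vertices = {pt a, pt b}" if "(a, b) \<in> set drawn_edges" for a b
    by (rule seg_vertices[OF straight_drawing_example that])
  then have "end_pairs example_vertices example_edges = (\<lambda>(a, b). {pt a, pt b}) ` set drawn_edges"
    unfolding end_pairs_def image_image by (intro image_cong) auto
  also have "\<dots> = (\<lambda>(i, j). {pt (vertex i), pt (vertex j)}) ` set edge_list"
    unfolding drawn_edges_def set_map image_image by (intro image_cong) auto
  finally show ?thesis .
qed

section \<open>The unique 3-colouring of the example\<close>

text \<open>Colour \<open>k\<close> belongs to the class of the vertex \<open>[0, 7, 9] ! k\<close>,
  so the list also assigns a representative to each vertex.\<close>

definition example_color :: "nat \<Rightarrow> nat" where
  "example_color i = [0, 1, 2, 0, 1, 2, 2, 1, 0, 2, 1] ! i"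

text \<open>The triangle 0, 7, 9 fixes the three colours, and every other vertex is reached by a sequence in which each
  vertex has two differently coloured predecessors.\<close>

lemma example_colorings:
  assumes "\<And>i. i < 11 \<Longrightarrow> d i < (3::nat)" "\<And>i j. (i, j) \<in> set edge_list \<Longrightarrow> d i \<noteq> d j"
  shows "i < 11 \<Longrightarrow> d i = d ([0, 7, 9] ! example_color i)"
    and "d 0 \<noteq> d 7" "d 0 \<noteq> d 9" "d 7 \<noteq> d 9"
proof -
  have b: "d 0 < 3" "d 1 < 3" "d 2 < 3" "d 3 < 3" "d 4 < 3" "d 5 < 3" "d 6 < 3" "d 7 < 3" "d 8 < 3"
    "d 9 < 3" "d 10 < 3" using assms(1) by simp_all
  have e: "d 0 \<noteq> d 1" "d 0 \<noteq> d 5" "d 0 \<noteq> d 7" "d 0 \<noteq> d 9" "d 1 \<noteq> d 9" "d 2 \<noteq> d 7" "d 2 \<noteq> d 8"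
    "d 3 \<noteq> d 4" "d 3 \<noteq> d 6" "d 3 \<noteq> d 7" "d 3 \<noteq> d 9" "d 4 \<noteq> d 9" "d 5 \<noteq> d 7" "d 6 \<noteq> d 7" "d 7 \<noteq> d 8"
    "d 7 \<noteq> d 9" "d 8 \<noteq> d 9" "d 8 \<noteq> d 10" "d 9 \<noteq> d 10"
    by (rule assms(2), simp add: edge_list_def)+
  show "d 0 \<noteq> d 7" "d 0 \<noteq> d 9" "d 7 \<noteq> d 9" using e by simp_all
  have same: "x = y" if "x < 3" "y < 3" "p < 3" "q < 3" "p \<noteq> q" "x \<noteq> p" "x \<noteq> q" "y \<noteq> p" "y \<noteq> q" for x y p q :: nat
    using that by linarith
  \<comment> \<open>The order matters: 4 and 6 are determined through 3, and 10 and 2 through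
    8.\<close>
  have "d 3 = d 0" by (rule same[of _ _ "d 7" "d 9"]) (use b e in auto)
  moreover have "d 8 = d 0" by (rule same[of _ _ "d 7" "d 9"]) (use b e in auto)
  moreover have "d 1 = d 7" by (rule same[of _ _ "d 0" "d 9"]) (use b e in auto)
  moreover have "d 5 = d 9" by (rule same[of _ _ "d 0" "d 7"]) (use b e in auto)
  moreover have "d 4 = d 7" by (rule same[of _ _ "d 0" "d 9"]) (use b e \<open>d 3 = d 0\<close> in auto)
  moreover have "d 6 = d 9" by (rule same[of _ _ "d 0" "d 7"]) (use b e \<open>d 3 = d 0\<close> in auto)
  moreover have "d 10 = d 7" by (rule same[of _ _ "d 0" "d 9"]) (use b e \<open>d 8 = d 0\<close> in auto)
  moreover have "d 2 = d 9" by (rule same[of _ _ "d 0" "d 7"]) (use b e \<open>d 8 = d 0\<close> in auto)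
  ultimately have "\<forall>i\<in>set [0..<11]. d i = d ([0, 7, 9] ! example_color i)"
    by (simp add: example_color_def upt_rec numeral_nat)
  then show "i < 11 \<Longrightarrow> d i = d ([0, 7, 9] ! example_color i)" by simp
qed

lemma example_proper_coloring:
  "proper_coloring example_vertices (end_pairs example_vertices example_edges) k c \<longleftrightarrow>
     (\<forall>i<11. c (pt (vertex i)) < k) \<and> (\<forall>(i, j)\<in>set edge_list. c (pt (vertex i)) \<noteq> c (pt (vertex j)))"
proof -
  let ?A = "(\<lambda>(i, j). {pt (vertex i), pt (vertex j)}) ` set edge_list"
  have "(\<forall>u v. {u, v} \<in> ?A \<longrightarrow> c u \<noteq> c v) \<longleftrightarrow>
      (\<forall>(i, j)\<in>set edge_list. c (pt (vertex i)) \<noteq> c (pt (vertex j)))" (is "?L \<longleftrightarrow> ?R")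
  proof
    assume L: ?L
    show ?R
    proof (intro ballI, clarify)
      fix i j assume ij: "(i, j) \<in> set edge_list" and eq: "c (pt (vertex i)) = c (pt (vertex j))"
      have "{pt (vertex i), pt (vertex j)} \<in> ?A" using ij by force
      from L[rule_format, OF this] show False using eq by simp
    qed
  next
    assume R: ?R
    show ?L
    proof (intro allI impI)
      fix u v assume "{u, v} \<in> ?A"
      then obtain i j where ij: "(i, j) \<in> set edge_list" "{u, v} = {pt (vertex i), pt (vertex j)}"
        by (elim imageE) auto
      have "c (pt (vertex i)) \<noteq> c (pt (vertex j))" using R ij(1) by blast
      then show "c u \<noteq> c v" using ij(2) unfolding doubleton_eq_iff by metis
    qed
  qed
  moreover have bound: "(\<forall>v\<in>example_vertices. c v < k) \<longleftrightarrow> (\<forall>i<11. c (pt (vertex i)) < k)"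
    unfolding example_vertices_eq by blast
  ultimately show ?thesis
    unfolding proper_coloring_def example_end_pairs bound by simp
qed

lemma example_coloring_classes:
  assumes "proper_coloring example_vertices (end_pairs example_vertices example_edges) 3 c"
  shows "i < 11 \<Longrightarrow> c (pt (vertex i)) = c (pt (vertex ([0, 7, 9] ! example_color i)))"
    and "c (pt (vertex 0)) \<noteq> c (pt (vertex 7))" "c (pt (vertex 0)) \<noteq> c (pt (vertex 9))"
    and "c (pt (vertex 7)) \<noteq> c (pt (vertex 9))"
    and "i < 11 \<Longrightarrow> c (pt (vertex i)) < 3"
proof -
  have 1: "c (pt (vertex i)) < 3" if "i < 11" for i
    using assms that unfolding example_proper_coloring by simp
  have 2: "c (pt (vertex i)) \<noteq> c (pt (vertex j))" if "(i, j) \<in> set edge_list" for i j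
    using assms that unfolding example_proper_coloring by blast
  note col = example_colorings[of "\<lambda>i. c (pt (vertex i))", OF 1 2]
  show "i < 11 \<Longrightarrow> c (pt (vertex i)) = c (pt (vertex ([0, 7, 9] ! example_color i)))"
    by (rule col(1))
  show "c (pt (vertex 0)) \<noteq> c (pt (vertex 7))" by (rule col(2))
  show "c (pt (vertex 0)) \<noteq> c (pt (vertex 9))" by (rule col(3))
  show "c (pt (vertex 7)) \<noteq> c (pt (vertex 9))" by (rule col(4))
  show "i < 11 \<Longrightarrow> c (pt (vertex i)) < 3" by (rule 1)
qed

lemma example_uniquely_colorable:
  "uniquely_colorable 3 example_vertices (end_pairs example_vertices example_edges)"
  unfolding uniquely_colorable_def
proof (intro conjI allI impI)
  let ?A = "end_pairs example_vertices example_edges"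
  show "chromatic_number example_vertices ?A = 3"
    unfolding chromatic_number_def
  proof (rule Least_equality)
    define c where "c x = example_color (THE i. i < 11 \<and> pt (vertex i) = x)" for x
    have c: "c (pt (vertex i)) = example_color i" if i: "i < 11" for i
    proof -
      have "(THE k. k < 11 \<and> pt (vertex k) = pt (vertex i)) = i"
        by (rule the_equality) (use i vertex_inj pt_inj in metis)+
      then show ?thesis by (simp add: c_def)
    qed
    have "\<forall>i\<in>set [0..<11]. example_color i < 3"
      and e: "\<forall>(i, j)\<in>set edge_list. i < 11 \<and> j < 11 \<and> example_color i \<noteq> example_color j"
      by code_simp+
    then have "\<forall>i<11. c (pt (vertex i)) < 3" using c by simp
    moreover have "\<forall>(i, j)\<in>set edge_list. c (pt (vertex i)) \<noteq> c (pt (vertex j))"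
      using e c by fastforce
    ultimately show "\<exists>c. proper_coloring example_vertices ?A 3 c"
      unfolding example_proper_coloring by blast
  next
    fix k assume "\<exists>c. proper_coloring example_vertices ?A k c"
    then obtain c where c: "\<forall>i<11. c (pt (vertex i)) < k"
      "\<forall>(i, j)\<in>set edge_list. c (pt (vertex i)) \<noteq> c (pt (vertex j))"
      unfolding example_proper_coloring by blast
    define d where "d i = c (pt (vertex i))" for i
    \<comment> \<open>The 3-cycle 0, 7, 9 alone needs three colours.\<close>
    have "d 0 < k" "d 7 < k" "d 9 < k" using c(1) by (simp_all add: d_def)
    moreover have "d 0 \<noteq> d 7" "d 0 \<noteq> d 9" "d 7 \<noteq> d 9"
      using c(2) by (simp_all add: d_def edge_list_def)
    ultimately show "3 \<le> k" by linarith
  qed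
next
  let ?A = "end_pairs example_vertices example_edges"
  fix c c' assume "proper_coloring example_vertices ?A 3 c \<and> proper_coloring example_vertices ?A 3 c'"
  then have cc: "proper_coloring example_vertices ?A 3 c" "proper_coloring example_vertices ?A 3 c'" by auto
  define a where "a k = c (pt (vertex ([0, 7, 9] ! k)))" for k
  define b where "b k = c' (pt (vertex ([0, 7, 9] ! k)))" for k
  have a: "a 0 \<noteq> a 1" "a 0 \<noteq> a 2" "a 1 \<noteq> a 2" "a 0 < 3" "a 1 < 3" "a 2 < 3"
    using example_coloring_classes(2-5)[OF cc(1)] by (simp_all add: a_def)
  have b: "b 0 \<noteq> b 1" "b 0 \<noteq> b 2" "b 1 \<noteq> b 2" "b 0 < 3" "b 1 < 3" "b 2 < 3"
    using example_coloring_classes(2-5)[OF cc(2)] by (simp_all add: b_def)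
  \<comment> \<open>Sends the colour of each representative under \<open>c\<close> to its colour
    under \<open>c'\<close>; the default \<open>x\<close> fixes all numbers from 3 on, as
    \<open>permutes\<close> demands.\<close>
  define \<pi> where "\<pi> x = (if x = a 0 then b 0 else if x = a 1 then b 1 else if x = a 2 then b 2 else x)" for x
  have lt3: "x = a 0 \<or> x = a 1 \<or> x = a 2" if "x < 3" for x using that a by linarith
  have "\<pi> permutes {..<3}"
  proof (rule inj_imp_permutes)
    show "inj_on \<pi> {..<3}"
    proof (rule inj_onI)
      fix x y assume "x \<in> {..<3}" "y \<in> {..<3}" "\<pi> x = \<pi> y"
      then show "x = y" using lt3[of x] lt3[of y] a b by (auto simp: \<pi>_def split: if_splits)
    qed
    show "\<pi> x \<in> {..<3}" if "x \<in> {..<3}" for x using that b by (auto simp: \<pi>_def)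
    show "\<pi> x = x" if "x \<notin> {..<3}" for x using that a by (auto simp: \<pi>_def)
  qed simp
  moreover have "c' v = \<pi> (c v)" if v: "v \<in> example_vertices" for v
  proof -
    obtain i where i: "i < 11" "v = pt (vertex i)" using v unfolding example_vertices_eq by blast
    have "\<forall>i\<in>set [0..<11]. example_color i < 3" by code_simp
    then have "example_color i = 0 \<or> example_color i = 1 \<or> example_color i = 2" using i by force
    moreover have "c v = a (example_color i)" "c' v = b (example_color i)"
      using example_coloring_classes(1)[OF cc(1) i(1)] example_coloring_classes(1)[OF cc(2) i(1)] i(2) by (simp_all add: a_def b_def)
    ultimately show ?thesis using a by (auto simp: \<pi>_def)
  qed
  ultimately show "\<exists>\<pi>. \<pi> permutes {..<3} \<and> (\<forall>v\<in>example_vertices. c' v = \<pi> (c v))" by blast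
qed

theorem theorem1p2:
  "(\<forall>V E. plane_graph V E \<and> uniquely_colorable 3 V (end_pairs V E) \<longrightarrow>
      (\<exists>k\<le>5. has_adjacent_faces V E 3 k)) \<and>
   (\<exists>V E. plane_graph V E \<and> uniquely_colorable 3 V (end_pairs V E) \<and>
      (\<forall>k\<le>4. \<not> has_adjacent_faces V E 3 k))"
proof (intro conjI allI impI)
  fix V E assume "plane_graph V E \<and> uniquely_colorable 3 V (end_pairs V E)"
  then show "\<exists>k\<le>5. has_adjacent_faces V E 3 k" using adjacent_triangle by blast
next
  have "plane_graph example_vertices example_edges"
    by (rule plane_graph_straight[OF straight_drawing_example])
  moreover have "\<forall>k\<le>4. \<not> has_adjacent_faces example_vertices example_edges 3 k"
    using no_small_adjacent_straight[OF straight_drawing_example pentagons_seen pentagons_cover] by simp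
  ultimately show "\<exists>V E. plane_graph V E \<and> uniquely_colorable 3 V (end_pairs V E) \<and>
      (\<forall>k\<le>4. \<not> has_adjacent_faces V E 3 k)"
    using example_uniquely_colorable by blast
qed

end
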